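(* Let $D\ge 1$ and, for each $d\in\{1,\dots,D\}$, let $J_d\ge 1$ and let $\phi_{d,1},\dots,\phi_{d,J_d}:\mathbb{R}\to\mathbb{R}$ be the Gaussian RBF basis functions $\phi_{d,j}(u)=\exp\!\big(-(u-c_{d,j})^2/(2l_d^2)\big)$ with centers $c_{d,j}\in\mathbb{R}$ and length scale $l_d>0$. Let $\sigma_w^2>0$ and let $w_{d,j}^{(m)}$, for $d\in\{1,\dots,D\}$, $j\in\{1,\dots,J_d\}$, $m\in\{1,2,\dots\}$, be i.i.d. $\mathcal{N}(0,\sigma_w^2)$ random variables (independent across all indices $(d,j,m)$). For each $M\ge 1$ and $x=(x_1,\dots,x_D)\in\mathbb{R}^D$ define the B-INN output with $M$ modes and its normalization by $$y^{(M)}(x)=\sum_{m=1}^M\prod_{d=1}^D\Big(\sum_{j=1}^{J_d}\phi_{d,j}(x_d)\,w_{d,j}^{(m)}\Big),\qquad \bar y^{(M)}(x)=\frac{1}{\sqrt{M}}\,y^{(M)}(x).$$ Then, as $M\to\infty$, $\bar y^{(M)}$ converges in finite-dimensional distributions to a centered Gaussian process $g\sim\mathrm{GP}(0,k)$ on $\mathbb{R}^D$ with kernel $$k(x,x')=\prod_{d=1}^D\Big(\sigma_w^2\sum_{j=1}^{J_d}\phi_{d,j}(x_d)\,\phi_{d,j}(x_d')\Big),\qquad x,x'\in\mathbb{R}^D.$$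
   Context: A centered Gaussian process $g\sim\mathrm{GP}(0,k)$ on $\mathbb{R}^D$ is a random function such that for any finitely many points $x^{(1)},\dots,x^{(n)}\in\mathbb{R}^D$ the vector $(g(x^{(1)}),\dots,g(x^{(n)}))$ is multivariate normal (possibly degenerate) with mean $0$ and covariance matrix $\big(k(x^{(i)},x^{(j)})\big)_{i,j}$. Convergence of $\bar y^{(M)}$ to $g$ in finite-dimensional distributions means that for every $n\ge 1$ and all $x^{(1)},\dots,x^{(n)}\in\mathbb{R}^D$, the random vector $(\bar y^{(M)}(x^{(1)}),\dots,\bar y^{(M)}(x^{(n)}))$ converges in distribution, as $M\to\infty$, to $(g(x^{(1)}),\dots,g(x^{(n)}))$. The numbers $D$, $J_d$, the centers $c_{d,j}$, the length scales $l_d$ and $\sigma_w^2$ are fixed and do not depend on $M$. *)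

theory Defs
  imports "HOL-Probability.Probability"
begin

(* A degenerate normal variable is an almost surely constant one. *)
definition normal_rv :: "'a measure \<Rightarrow> ('a \<Rightarrow> real) \<Rightarrow> bool" where
  "normal_rv P X \<longleftrightarrow>
     (\<exists>\<mu> \<sigma>. \<sigma> > 0 \<and> distributed P lborel X (normal_density \<mu> \<sigma>)) \<or>
     (X \<in> borel_measurable P \<and> (\<exists>\<mu>. AE \<omega> in P. X \<omega> = \<mu>))"

(* The random vector (X 0, ..., X (n-1)) is jointly normal, possibly degenerate: every linear
   combination of its entries is normal. *)
definition multivariate_normal :: "'a measure \<Rightarrow> nat \<Rightarrow> (nat \<Rightarrow> 'a \<Rightarrow> real) \<Rightarrow> bool" where
  "multivariate_normal P n X \<longleftrightarrow>
     (\<forall>a :: nat \<Rightarrow> real. normal_rv P (\<lambda>\<omega>. \<Sum>i<n. a i * X i \<omega>))"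

definition covariance :: "'a measure \<Rightarrow> ('a \<Rightarrow> real) \<Rightarrow> ('a \<Rightarrow> real) \<Rightarrow> real" where
  "covariance P X Y =
     (\<integral>\<omega>. (X \<omega> - (\<integral>\<omega>'. X \<omega>' \<partial>P)) * (Y \<omega> - (\<integral>\<omega>'. Y \<omega>' \<partial>P)) \<partial>P)"

(* GP(0, k) on the index set 'x. The points x 0, ..., x (n-1) need not be distinct. *)
definition centered_GP :: "'a measure \<Rightarrow> ('x \<Rightarrow> 'a \<Rightarrow> real) \<Rightarrow> ('x \<Rightarrow> 'x \<Rightarrow> real) \<Rightarrow> bool" where
  "centered_GP P g k \<longleftrightarrow> prob_space P \<and>
     (\<forall>n\<ge>1. \<forall>x :: nat \<Rightarrow> 'x.
        multivariate_normal P n (\<lambda>i. g (x i)) \<and>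
        (\<forall>i<n. (\<integral>\<omega>. g (x i) \<omega> \<partial>P) = 0) \<and>
        (\<forall>i<n. \<forall>j<n. covariance P (g (x i)) (g (x j)) = k (x i) (x j)))"

(* Points of R^n are the functions in PiE {..<n} (\<lambda>_. UNIV), with the product topology and the
   product sigma-algebra. *)
definition random_tuple :: "nat \<Rightarrow> (nat \<Rightarrow> 'a \<Rightarrow> real) \<Rightarrow> 'a \<Rightarrow> (nat \<Rightarrow> real)" where
  "random_tuple n X \<omega> = (\<lambda>i\<in>{..<n}. X i \<omega>)"

(* Convergence in distribution of R^n-valued random vectors: convergence of the expectations of
   all bounded continuous functions. *)
definition converges_in_distribution ::
    "nat \<Rightarrow> 'a measure \<Rightarrow> (nat \<Rightarrow> nat \<Rightarrow> 'a \<Rightarrow> real) \<Rightarrow> 'b measure \<Rightarrow> (nat \<Rightarrow> 'b \<Rightarrow> real) \<Rightarrow> bool" where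
  "converges_in_distribution n P X Q Y \<longleftrightarrow>
     (\<forall>M. random_tuple n (X M) \<in> measurable P (PiM {..<n} (\<lambda>_. borel))) \<and>
     random_tuple n Y \<in> measurable Q (PiM {..<n} (\<lambda>_. borel)) \<and>
     (\<forall>f :: (nat \<Rightarrow> real) \<Rightarrow> real.
        continuous_on (PiE {..<n} (\<lambda>_. UNIV)) f \<and> bounded (f ` PiE {..<n} (\<lambda>_. UNIV)) \<longrightarrow>
        (\<lambda>M. \<integral>\<omega>. f (random_tuple n (X M) \<omega>) \<partial>P) \<longlonglongrightarrow> (\<integral>\<omega>. f (random_tuple n Y \<omega>) \<partial>Q))"

definition fdd_converges ::
    "'a measure \<Rightarrow> (nat \<Rightarrow> 'x \<Rightarrow> 'a \<Rightarrow> real) \<Rightarrow> 'b measure \<Rightarrow> ('x \<Rightarrow> 'b \<Rightarrow> real) \<Rightarrow> bool" where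
  "fdd_converges P Y Q g \<longleftrightarrow>
     (\<forall>n\<ge>1. \<forall>x :: nat \<Rightarrow> 'x.
        converges_in_distribution n P (\<lambda>M i. Y M (x i)) Q (\<lambda>i. g (x i)))"

definition gaussian_rbf :: "real \<Rightarrow> real \<Rightarrow> real \<Rightarrow> real" where
  "gaussian_rbf c l u = exp (- ((u - c)\<^sup>2 / (2 * l\<^sup>2)))"

(* 'd indexes the D = CARD('d) input dimensions; the basis functions of dimension d are numbered
   1, ..., J d, the modes 1, ..., M, and w d j m is the weight of basis function j in mode m. *)
definition binn_output ::
    "('d::finite \<Rightarrow> nat) \<Rightarrow> ('d \<Rightarrow> nat \<Rightarrow> real) \<Rightarrow> ('d \<Rightarrow> real) \<Rightarrow> ('d \<Rightarrow> nat \<Rightarrow> nat \<Rightarrow> 'a \<Rightarrow> real) \<Rightarrow>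
     nat \<Rightarrow> real ^ 'd \<Rightarrow> 'a \<Rightarrow> real" where
  "binn_output J c l w M x \<omega> =
     (\<Sum>m=1..M. \<Prod>d\<in>UNIV. \<Sum>j=1..J d. gaussian_rbf (c d j) (l d) (x $ d) * w d j m \<omega>)"

definition binn_normalized ::
    "('d::finite \<Rightarrow> nat) \<Rightarrow> ('d \<Rightarrow> nat \<Rightarrow> real) \<Rightarrow> ('d \<Rightarrow> real) \<Rightarrow> ('d \<Rightarrow> nat \<Rightarrow> nat \<Rightarrow> 'a \<Rightarrow> real) \<Rightarrow>
     nat \<Rightarrow> real ^ 'd \<Rightarrow> 'a \<Rightarrow> real" where
  "binn_normalized J c l w M x \<omega> = 1 / sqrt (real M) * binn_output J c l w M x \<omega>"

definition binn_kernel ::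
    "('d::finite \<Rightarrow> nat) \<Rightarrow> ('d \<Rightarrow> nat \<Rightarrow> real) \<Rightarrow> ('d \<Rightarrow> real) \<Rightarrow> real \<Rightarrow> real ^ 'd \<Rightarrow> real ^ 'd \<Rightarrow> real" where
  "binn_kernel J c l \<sigma>w x x' =
     (\<Prod>d\<in>UNIV. \<sigma>w\<^sup>2 *
        (\<Sum>j=1..J d. gaussian_rbf (c d j) (l d) (x $ d) * gaussian_rbf (c d j) (l d) (x' $ d)))"

end

theory Submission
  imports Defs
begin

text \<open>
  Expanding the product over the dimensions, the kernel has finite rank: it equals
  \<open>\<Sum>\<alpha>. \<Phi> \<alpha> x * \<Phi> \<alpha> y\<close> over the choices \<open>\<alpha>\<close> of one basis function per dimension. So a Gaussian
  process with this kernel is \<open>\<Sum>\<alpha>. \<Phi> \<alpha> x * Z \<alpha>\<close> with independent standard normal \<open>Z \<alpha>\<close>, while each mode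
  of the network is \<open>\<Sum>\<alpha>. \<Phi> \<alpha> x * V \<alpha>\<close> with \<open>V \<alpha>\<close> the product over \<open>d\<close> of the normalized weights
  \<open>w d (\<alpha> d)\<close>. The \<open>V \<alpha>\<close> are orthonormal and centered, so every linear combination
  of values of a mode has the same variance as that of the process, and the one-dimensional central limit
  theorem gives convergence of all characteristic functions.

  For the passage from characteristic functions to convergence in distribution on \<open>\<real>\<^sup>n\<close>, a bounded
  weight turns the one-dimensional Levy theorem into a statement that replaces one trigonometric
  factor at a time by an arbitrary bounded continuous function of that coordinate. Sums of products
  of such functions approximate any bounded continuous function on a box by Stone-Weierstrass, and
  a product cut-off controls what happens outside the box.
\<close>

section \<open>Levy's continuity theorem in several dimensions\<close>

text \<open>Levy's continuity theorem for the laws of \<open>X\<close> under the measures with density \<open>W\<close>, normalized.\<close>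

lemma positive_weighted_Levy_continuity:
  fixes N :: "nat \<Rightarrow> 'a measure" and N' :: "'a measure" and X W :: "'a \<Rightarrow> real" and h :: "real \<Rightarrow> real"
  assumes N: "\<And>m. prob_space (N m)" "prob_space N'"
    and X: "\<And>m. X \<in> borel_measurable (N m)" "X \<in> borel_measurable N'"
    and W: "\<And>m. W \<in> borel_measurable (N m)" "W \<in> borel_measurable N'"
    and W_bounds: "\<And>x. 1 \<le> W x" "\<And>x. W x \<le> B"
    and cos_conv: "\<And>s b. (\<lambda>m. \<integral>x. W x * cos (s * X x + b) \<partial>N m) \<longlonglongrightarrow> (\<integral>x. W x * cos (s * X x + b) \<partial>N')"
    and h: "continuous_on UNIV h" "\<And>x. \<bar>h x\<bar> \<le> C"
  shows "(\<lambda>m. \<integral>x. W x * h (X x) \<partial>N m) \<longlonglongrightarrow> (\<integral>x. W x * h (X x) \<partial>N')"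
proof -
  define c where "c K = (\<integral>x. W x \<partial>K)" for K
  define \<mu> where "\<mu> K = distr (density K (\<lambda>x. ennreal (W x / c K))) borel X" for K
  have hm [measurable]: "h \<in> borel_measurable borel"
    using h(1) by (rule borel_measurable_continuous_onI)
  have tilt: "c K \<ge> 1 \<and> real_distribution (\<mu> K) \<and>
      (\<forall>t. char (\<mu> K) t = Complex ((\<integral>x. W x * cos (t * X x + 0) \<partial>K) / c K)
          ((\<integral>x. W x * cos (t * X x + (-pi/2)) \<partial>K) / c K)) \<and>
      c K * integral\<^sup>L (\<mu> K) h = (\<integral>x. W x * h (X x) \<partial>K)"
    if K: "prob_space K" and [measurable]: "X \<in> borel_measurable K" "W \<in> borel_measurable K" for K
  proof (intro conjI allI)
    interpret K: prob_space K by fact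
    have iW [simp]: "integrable K W"
      by (rule K.integrable_const_bound[of _ B])
          (use W_bounds in \<open>auto intro!: AE_I2 simp: abs_of_nonneg order_trans[OF zero_le_one]\<close>)
    show c1: "c K \<ge> 1"
      using integral_mono[of K "\<lambda>_. 1" W] W_bounds by (simp add: c_def K.prob_space)
    have W0: "0 \<le> W x" "0 \<le> W x / c K" for x using W_bounds(1)[of x] c1 by auto
    have "prob_space (density K (\<lambda>x. ennreal (W x / c K)))"
    proof
      have "(\<integral>\<^sup>+x. ennreal (W x / c K) \<partial>K) = ennreal (\<integral>x. W x / c K \<partial>K)"
        by (rule nn_integral_eq_integral) (use W0 in auto)
      also have "(\<integral>x. W x / c K \<partial>K) = 1" using c1 by (simp add: c_def)
      finally show "emeasure (density K (\<lambda>x. ennreal (W x / c K))) (space (density K (\<lambda>x. ennreal (W x / c K)))) = 1"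
        by (simp add: emeasure_density cong: nn_integral_cong)
    qed
    then show "real_distribution (\<mu> K)"
      unfolding \<mu>_def by (intro prob_space.real_distribution_distr) auto
    then interpret \<mu>: real_distribution "\<mu> K" .
    have int\<mu>: "integral\<^sup>L (\<mu> K) k = (\<integral>x. W x * k (X x) \<partial>K) / c K"
      if [measurable]: "k \<in> borel_measurable borel" for k :: "real \<Rightarrow> real"
      unfolding \<mu>_def
      by (subst integral_distr, simp_all, subst integral_density) (use W0 in auto)
    show "c K * integral\<^sup>L (\<mu> K) h = (\<integral>x. W x * h (X x) \<partial>K)"
      using c1 by (simp add: int\<mu>)
    fix t
    have ie: "integrable (\<mu> K) (\<lambda>x. iexp (t * x))" by (rule \<mu>.integrable_iexp) auto
    have "Re (char (\<mu> K) t) = (\<integral>x. cos (t * x) \<partial>\<mu> K)" "Im (char (\<mu> K) t) = (\<integral>x. sin (t * x) \<partial>\<mu> K)"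
      unfolding char_def by (subst integral_Re[symmetric] integral_Im[symmetric], rule ie, simp add: Re_exp Im_exp)+
    \<comment> \<open>A phase of \<open>-pi/2\<close> turns the cosine into a sine, so the single
      hypothesis on shifted cosines yields both the real and the imaginary part.\<close>
    then show "char (\<mu> K) t = Complex ((\<integral>x. W x * cos (t * X x + 0) \<partial>K) / c K)
          ((\<integral>x. W x * cos (t * X x + (-pi/2)) \<partial>K) / c K)"
      by (simp add: complex_eq_iff int\<mu> cos_diff)
  qed
  note tN = tilt[OF N(1) X(1) W(1)] and tN' = tilt[OF N(2) X(2) W(2)]
  \<comment> \<open>At frequency and phase zero the hypothesis is convergence of the total masses,
    which allows the division by \<open>c\<close>.\<close>
  have c_conv: "(\<lambda>m. c (N m)) \<longlonglongrightarrow> c N'"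
    using cos_conv[of 0 0] by (simp add: c_def)
  have "weak_conv_m (\<lambda>m. \<mu> (N m)) (\<mu> N')"
  proof (rule levy_continuity)
    show "(\<lambda>m. char (\<mu> (N m)) t) \<longlonglongrightarrow> char (\<mu> N') t" for t
      unfolding tN[THEN conjunct2, THEN conjunct2, THEN conjunct1, rule_format]
        tN'[THEN conjunct2, THEN conjunct2, THEN conjunct1, rule_format]
      by (intro tendsto_Complex tendsto_divide cos_conv c_conv) (use tN' in auto)
  qed (use tN tN' in auto)
  then have "(\<lambda>m. integral\<^sup>L (\<mu> (N m)) h) \<longlonglongrightarrow> integral\<^sup>L (\<mu> N') h"
    by (rule weak_conv_imp_integral_bdd_continuous_conv[rotated 2, where B=C])
       (use tN tN' h in \<open>auto simp: continuous_on_eq_continuous_at\<close>)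
  then have "(\<lambda>m. c (N m) * integral\<^sup>L (\<mu> (N m)) h) \<longlonglongrightarrow> c N' * integral\<^sup>L (\<mu> N') h"
    by (intro tendsto_mult c_conv)
  then show ?thesis
    using tN tN' by simp
qed

text \<open>A bounded signed weight becomes a weight that is at least 1 after adding
  \<open>B + 1\<close>. The positive case applies to the shifted weight and to the constant weight
  1; subtracting \<open>B + 1\<close> times the second limit from the first isolates the
  contribution of \<open>G\<close>.\<close>

lemma weighted_Levy_continuity:
  fixes N :: "nat \<Rightarrow> 'a measure" and N' :: "'a measure" and X G :: "'a \<Rightarrow> real" and h :: "real \<Rightarrow> real"
  assumes N: "\<And>m. prob_space (N m)" "prob_space N'"
    and X: "\<And>m. X \<in> borel_measurable (N m)" "X \<in> borel_measurable N'"
    and G: "\<And>m. G \<in> borel_measurable (N m)" "G \<in> borel_measurable N'"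
    and G_bound: "\<And>x. \<bar>G x\<bar> \<le> B"
    and cos_conv: "\<And>s b. (\<lambda>m. \<integral>x. cos (s * X x + b) \<partial>N m) \<longlonglongrightarrow> (\<integral>x. cos (s * X x + b) \<partial>N')"
    and weighted_conv: "\<And>s b. (\<lambda>m. \<integral>x. G x * cos (s * X x + b) \<partial>N m) \<longlonglongrightarrow>
        (\<integral>x. G x * cos (s * X x + b) \<partial>N')"
    and h: "continuous_on UNIV h" "\<And>x. \<bar>h x\<bar> \<le> C"
  shows "(\<lambda>m. \<integral>x. G x * h (X x) \<partial>N m) \<longlonglongrightarrow> (\<integral>x. G x * h (X x) \<partial>N')"
proof -
  have hm [measurable]: "h \<in> borel_measurable borel"
    using h(1) by (rule borel_measurable_continuous_onI)
  define W where "W x = B + 1 + G x" for x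
  have W_bounds: "1 \<le> W x" "W x \<le> 2 * B + 1" for x
    using G_bound[of x] by (auto simp: W_def abs_le_iff)
  have split: "(\<integral>x. W x * k (X x) \<partial>K) = (B + 1) * (\<integral>x. k (X x) \<partial>K) + (\<integral>x. G x * k (X x) \<partial>K)"
    if "prob_space K" and [measurable]: "X \<in> borel_measurable K" "G \<in> borel_measurable K"
      and [measurable]: "k \<in> borel_measurable borel" and k: "\<And>x. \<bar>k x\<bar> \<le> D" for k D K
  proof -
    interpret prob_space K by fact
    have "integrable K (\<lambda>x. k (X x))"
      by (rule integrable_const_bound[of _ D]) (use k in auto)
    moreover have "integrable K (\<lambda>x. G x * k (X x))"
      by (rule integrable_const_bound[of _ "B * D"])
         (use k G_bound in \<open>auto simp: abs_mult intro!: mult_mono AE_I2 order_trans[OF abs_ge_zero G_bound]\<close>)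
    ultimately show ?thesis by (simp add: W_def algebra_simps)
  qed
  have [measurable]: "W \<in> borel_measurable (N m)" for m
    unfolding W_def using G by measurable
  have [measurable]: "W \<in> borel_measurable N'"
    unfolding W_def using G by measurable
  have "(\<lambda>m. \<integral>x. W x * h (X x) \<partial>N m) \<longlonglongrightarrow> (\<integral>x. W x * h (X x) \<partial>N')"
  proof (rule positive_weighted_Levy_continuity[OF N X _ _ W_bounds _ h])
    show "(\<lambda>m. \<integral>x. W x * cos (s * X x + b) \<partial>N m) \<longlonglongrightarrow> (\<integral>x. W x * cos (s * X x + b) \<partial>N')" for s b
      using split[OF N(1) X(1) G(1), of "\<lambda>u. cos (s * u + b)" 1] split[OF N(2) X(2) G(2), of "\<lambda>u. cos (s * u + b)" 1]
      by (auto intro!: tendsto_add tendsto_mult_left cos_conv weighted_conv)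
  qed auto
  moreover have "(\<lambda>m. \<integral>x. 1 * h (X x) \<partial>N m) \<longlonglongrightarrow> (\<integral>x. 1 * h (X x) \<partial>N')"
    by (rule positive_weighted_Levy_continuity[OF N X, where B=1 and C=C]) (use h cos_conv in auto)
  ultimately have "(\<lambda>m. (\<integral>x. W x * h (X x) \<partial>N m) - (B + 1) * (\<integral>x. h (X x) \<partial>N m)) \<longlonglongrightarrow>
     (\<integral>x. W x * h (X x) \<partial>N') - (B + 1) * (\<integral>x. h (X x) \<partial>N')"
    by (intro tendsto_diff tendsto_mult_left) auto
  then show ?thesis
    using split[OF N(1) X(1) G(1) hm h(2)] split[OF N(2) X(2) G(2) hm h(2)] by simp
qed

text \<open>The coordinates below \<open>k\<close> already carry arbitrary functions, while the
  others still sit inside the cosine. To release coordinate \<open>k\<close>, everything that does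
  not depend on it is taken as the weight in the one-dimensional theorem.\<close>

lemma product_cos_convergence:
  fixes N :: "nat \<Rightarrow> (nat \<Rightarrow> real) measure" and N' :: "(nat \<Rightarrow> real) measure" and h ::
      "nat \<Rightarrow> real \<Rightarrow> real"
  assumes N: "\<And>m. prob_space (N m)" "prob_space N'"
    and sets [measurable_cong]: "\<And>m. sets (N m) = sets (PiM {..<n} (\<lambda>_. borel))"
        "sets N' = sets (PiM {..<n} (\<lambda>_. borel))"
    and cos_conv: "\<And>t b. (\<lambda>m. \<integral>x. cos ((\<Sum>i<n. t i * x i) + b) \<partial>N m) \<longlonglongrightarrow>
        (\<integral>x. cos ((\<Sum>i<n. t i * x i) + b) \<partial>N')"
    and h: "\<And>i. continuous_on UNIV (h i)" "\<And>i x. \<bar>h i x\<bar> \<le> C i"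
    and "k \<le> n"
  shows "(\<lambda>m. \<integral>x. (\<Prod>i<k. h i (x i)) * cos ((\<Sum>i=k..<n. t i * x i) + b) \<partial>N m) \<longlonglongrightarrow>
    (\<integral>x. (\<Prod>i<k. h i (x i)) * cos ((\<Sum>i=k..<n. t i * x i) + b) \<partial>N')"
  using \<open>k \<le> n\<close>
\<comment> \<open>Frequencies and phase stay general: the step uses the induction hypothesis with a
  new frequency at \<open>k\<close> and with the phases \<open>b + b'\<close> and
  \<open>b - b'\<close>.\<close>
proof (induction k arbitrary: t b)
  case 0
  then show ?case using cos_conv by (simp add: atLeast0LessThan)
next
  case (Suc k)
  have [measurable]: "h i \<in> borel_measurable borel" for i
    using h(1) by (rule borel_measurable_continuous_onI)
  have prod_bound: "\<bar>\<Prod>i<j. h i (x i)\<bar> \<le> (\<Prod>i<j. C i)" for j x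
    unfolding abs_prod by (intro prod_mono) (use h(2) in auto)
  have prod_cos_bound: "\<bar>(\<Prod>i<k. h i (x i)) * cos u\<bar> \<le> (\<Prod>i<k. C i)" for x u
    unfolding abs_mult by (rule order_trans[OF mult_left_le[OF abs_cos_le_one abs_ge_zero] prod_bound])
  define G where "G x = (\<Prod>i<k. h i (x i)) * cos ((\<Sum>i=Suc k..<n. t i * x i) + b)" for x ::
      "nat \<Rightarrow> real"
  have G_meas: "G \<in> borel_measurable (PiM {..<n} (\<lambda>_. borel))"
    unfolding G_def by measurable (use Suc.prems in auto)
  have G_bound: "\<bar>G x\<bar> \<le> (\<Prod>i<k. C i)" for x
    unfolding G_def by (rule prod_cos_bound)
  have [measurable]: "(\<lambda>x. x k) \<in> borel_measurable (PiM {..<n} (\<lambda>_. borel))"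
    using Suc.prems by (intro measurable_component_singleton) auto
  have "(\<lambda>m. \<integral>x. G x * h k (x k) \<partial>N m) \<longlonglongrightarrow> (\<integral>x. G x * h k (x k) \<partial>N')"
  proof (rule weighted_Levy_continuity[OF N _ _ _ _ G_bound _ _ h(1) h(2)])
    fix s b'
    \<comment> \<open>Frequencies supported at \<open>k\<close> alone give the convergence of the
      marginal.\<close>
    show "(\<lambda>m. \<integral>x. cos (s * x k + b') \<partial>N m) \<longlonglongrightarrow> (\<integral>x. cos (s * x k + b') \<partial>N')"
      using cos_conv[of "\<lambda>i. if i = k then s else 0" b'] Suc.prems
      by (simp add: if_distrib[of "\<lambda>u. u * _"] cong: if_cong)
    let ?F = "\<lambda>s b x. (\<Prod>i<k. h i (x i)) * cos ((\<Sum>i=k..<n. (t(k := s)) i * x i) + b)"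
    have F_meas: "?F s b \<in> borel_measurable (PiM {..<n} (\<lambda>_. borel))" for s b
      by measurable (use Suc.prems in auto)
    have sum_upd: "(\<Sum>i=k..<n. (t(k := s)) i * x i) = s * x k + (\<Sum>i=Suc k..<n. t i * x i)" for s x
      using Suc.prems by (simp add: sum.atLeast_Suc_lessThan)
    \<comment> \<open>Product-to-sum formula: two cosines merge into integrands of the shape covered
      by the induction hypothesis.\<close>
    have eq: "G x * cos (s * x k + b') = (?F s (b + b') x + ?F (-s) (b - b') x) / 2" for x
      unfolding G_def sum_upd by (simp add: cos_add cos_diff sin_add sin_diff algebra_simps)
    have int: "integrable K (?F s b)" if "prob_space K" "sets K = sets (PiM {..<n} (\<lambda>_. borel))"
        for K s b
    proof -
      interpret prob_space K by fact
      have "?F s b \<in> borel_measurable K" using F_meas that(2) by (simp cong: measurable_cong_sets)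
      moreover have "\<bar>?F s b x\<bar> \<le> (\<Prod>i<k. C i)" for x
        by (rule prod_cos_bound)
      ultimately show ?thesis by (intro integrable_const_bound[of _ "\<Prod>i<k. C i"]) auto
    qed
    show "(\<lambda>m. \<integral>x. G x * cos (s * x k + b') \<partial>N m) \<longlonglongrightarrow> (\<integral>x. G x * cos (s * x k + b') \<partial>N')"
      unfolding eq using Suc.prems
      by (simp only: integral_divide_zero Bochner_Integration.integral_add[OF int[OF N(1) sets(1)] int[OF N(1) sets(1)]]
          Bochner_Integration.integral_add[OF int[OF N(2) sets(2)] int[OF N(2) sets(2)]])
        (intro tendsto_divide tendsto_add tendsto_const Suc.IH; simp)
  qed (use G_meas in \<open>auto cong: measurable_cong_sets simp: sets\<close>)
  then show ?case
    by (simp add: G_def mult_ac)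
qed

section \<open>The algebra of sums of products of one-coordinate functions\<close>

inductive_set product_sums :: "nat \<Rightarrow> ((nat \<Rightarrow> real) \<Rightarrow> real) set" for n :: nat where
  prod: "(\<And>i. continuous_on UNIV (h i)) \<Longrightarrow> (\<And>i. bounded (range (h i))) \<Longrightarrow>
    (\<lambda>x. c * (\<Prod>i<n. h i (x i))) \<in> product_sums n"
| add: "f \<in> product_sums n \<Longrightarrow> g \<in> product_sums n \<Longrightarrow> (\<lambda>x. f x + g x) \<in> product_sums n"

text \<open>Two induction steps reduce to a pair of single products, which multiply coordinate by
  coordinate. Closure under products makes the set a function ring, as Stone-Weierstrass
  requires.\<close>

lemma product_sums_mult:
  assumes "f \<in> product_sums n" "g \<in> product_sums n"
  shows "(\<lambda>x. f x * g x) \<in> product_sums n"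
  using assms
proof (induction f)
  case (prod h c)
  note h = prod.hyps
  from prod.prems show ?case
  proof (induction g)
    case (prod h' c')
    have "bounded (range (\<lambda>u. h i u * h' i u))" for i
      using h(2)[of i] prod(2)[of i]
          by (auto simp: bounded_iff abs_mult intro!: mult_mono) (meson abs_ge_zero mult_mono order_trans)
    moreover have "(\<lambda>x. (c * (\<Prod>i<n. h i (x i))) * (c' * (\<Prod>i<n. h' i (x i)))) =
        (\<lambda>x. (c * c') * (\<Prod>i<n. h i (x i) * h' i (x i)))"
      by (simp add: prod.distrib mult_ac)
    moreover have "continuous_on UNIV (\<lambda>u. h i u * h' i u)" for i
      by (intro continuous_intros h prod)
    ultimately show ?case
      using product_sums.prod[of "\<lambda>i u. h i u * h' i u" "c * c'" n] by simp
  next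
    case (add f g)
    then show ?case by (auto simp: distrib_left intro: product_sums.add)
  qed
next
  case (add f1 f2)
  then show ?case by (auto simp: distrib_right intro: product_sums.add)
qed

lemma product_sums_const: "(\<lambda>_. c) \<in> product_sums n"
  \<comment> \<open>The constant sits in the scalar of the rule \<open>prod\<close> rather than in a
    factor, so \<open>n = 0\<close> with its empty product is covered.\<close>
  using product_sums.prod[of "\<lambda>_ _. 1" c n] by simp

lemma product_sums_coordinate:
  assumes "continuous_on UNIV h" "bounded (range h)" "i < n"
  shows "(\<lambda>x. h (x i)) \<in> product_sums n"
proof -
  have "continuous_on UNIV (if j = i then h else (\<lambda>_. 1))"
      "bounded (range (if j = i then h else (\<lambda>_. 1)))" for j
    using assms by auto
  moreover have "(\<lambda>x. 1 * (\<Prod>j<n. (if j = i then h else (\<lambda>_. 1)) (x j))) = (\<lambda>x. h (x i))"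
    using assms(3) by (simp add: if_distrib[of "\<lambda>k. k _"] prod.delta cong: if_cong)
  ultimately show ?thesis
    using product_sums.prod[of "\<lambda>j. if j = i then h else (\<lambda>_. 1)" 1 n] by (simp only:)
qed

lemma product_sums_continuous:
  assumes "f \<in> product_sums n"
  shows "continuous_on UNIV f"
  using assms
proof induction
  case (prod h c)
  have "continuous_on UNIV (\<lambda>x :: nat \<Rightarrow> real. h i (x i))" for i
    by (rule continuous_on_compose2[OF prod(1)]) (auto intro: continuous_on_product_coordinates)
  then show ?case by (intro continuous_intros)
qed (intro continuous_intros)

lemma product_sums_bounded:
  assumes "f \<in> product_sums n"
  shows "bounded (range f)"
  using assms
proof induction
  case (prod h c)
  then obtain B where B: "\<bar>h i x\<bar> \<le> B i" for i x
    unfolding bounded_iff by simp metis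
  have "\<bar>c * (\<Prod>i<n. h i (x i))\<bar> \<le> \<bar>c\<bar> * (\<Prod>i<n. B i)" for x
    unfolding abs_mult abs_prod by (intro mult_left_mono prod_mono) (use B in auto)
  then show ?case unfolding bounded_iff by auto
qed (auto intro: bounded_plus_comp)

section \<open>Measurability and compactness in \<open>PiE\<close>\<close>

lemma borel_measurable_continuous_on_PiE:
  fixes f :: "('i::countable \<Rightarrow> real) \<Rightarrow> real"
  assumes "continuous_on (PiE I (\<lambda>_. UNIV)) f"
  shows "f \<in> borel_measurable (PiM I (\<lambda>_. borel))"
proof -
  \<comment> \<open>Composing with the restriction map extends \<open>f\<close> continuously to all
    functions, and on that full countable product the Borel sets are those of the product
    sigma-algebra.\<close>
  have "continuous_on UNIV (\<lambda>x :: 'i \<Rightarrow> real. restrict x I)"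
  proof (rule continuous_on_coordinatewise_then_product)
    show "continuous_on UNIV (\<lambda>x :: 'i \<Rightarrow> real. restrict x I i)" for i
      by (cases "i \<in> I") (auto intro: continuous_on_product_coordinates)
  qed
  then have "continuous_on UNIV (\<lambda>x. f (restrict x I))"
    by (rule continuous_on_compose2[OF assms]) auto
  then have "(\<lambda>x. f (restrict x I)) \<in> borel_measurable (PiM UNIV (\<lambda>_. borel))"
    using borel_measurable_continuous_onI
        by (simp cong: measurable_cong_sets add: sets_PiM_equal_borel)
  \<comment> \<open>The inclusion is measurable because every coordinate outside \<open>I\<close> is
    constantly \<open>undefined\<close>.\<close>
  moreover have "(\<lambda>x. x) \<in> measurable (PiM I (\<lambda>_. borel)) (PiM UNIV (\<lambda>_. borel :: real measure))"
  proof (rule measurable_PiM_single')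
    fix i :: 'i
    show "(\<lambda>x. x i) \<in> borel_measurable (PiM I (\<lambda>_. borel :: real measure))"
    proof (cases "i \<in> I")
      case False
      then have "(\<lambda>x. x i) \<in> borel_measurable (PiM I (\<lambda>_. borel :: real measure)) \<longleftrightarrow>
         (\<lambda>x. undefined :: real) \<in> borel_measurable (PiM I (\<lambda>_. borel :: real measure))"
        by (intro measurable_cong) (auto simp: space_PiM PiE_def extensional_def)
      then show ?thesis by simp
    qed simp
  qed (auto simp: space_PiM)
  ultimately have "(\<lambda>x. f (restrict x I)) \<in> borel_measurable (PiM I (\<lambda>_. borel))"
    by (rule measurable_compose[rotated])
  then show ?thesis
    by (rule measurable_cong[THEN iffD1, rotated]) (auto simp: space_PiM PiE_def extensional_restrict)
qed

text \<open>Tychonoff's theorem, once the box is written as a product over all indices with the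
  singleton \<open>{undefined}\<close> as factor outside \<open>I\<close>.\<close>

lemma compact_PiE_box:
  fixes a b :: real
  shows "compact (PiE I (\<lambda>_. {a..b}))"
proof -
  have "PiE I (\<lambda>_. {a..b}) = PiE UNIV (\<lambda>i. if i \<in> I then {a..b} else {undefined})"
    by (auto simp: PiE_def Pi_def extensional_def split: if_splits)
  moreover have "compactin (product_topology (\<lambda>_. euclidean) UNIV) (PiE UNIV (\<lambda>i. if i \<in> I then {a..b} else {undefined}))"
    by (subst compactin_PiE) auto
  ultimately show ?thesis by (simp add: euclidean_product_topology)
qed

lemma product_sums_convergence:
  fixes N :: "nat \<Rightarrow> (nat \<Rightarrow> real) measure" and N' :: "(nat \<Rightarrow> real) measure"
  assumes N: "\<And>m. prob_space (N m)" "prob_space N'"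
    and sets: "\<And>m. sets (N m) = sets (PiM {..<n} (\<lambda>_. borel))"
        "sets N' = sets (PiM {..<n} (\<lambda>_. borel))"
    and cos_conv: "\<And>t b. (\<lambda>m. \<integral>x. cos ((\<Sum>i<n. t i * x i) + b) \<partial>N m) \<longlonglongrightarrow>
        (\<integral>x. cos ((\<Sum>i<n. t i * x i) + b) \<partial>N')"
    and "f \<in> product_sums n"
  shows "(\<lambda>m. integral\<^sup>L (N m) f) \<longlonglongrightarrow> integral\<^sup>L N' f"
  using \<open>f \<in> product_sums n\<close>
proof induction
  case (prod h c)
  from prod(2) obtain B where B: "\<bar>h i x\<bar> \<le> B i" for i x
    unfolding bounded_iff by simp metis
  \<comment> \<open>With \<open>k = n\<close> no coordinate is left in the cosine, which becomes
    \<open>cos 0 = 1\<close>.\<close>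
  from product_cos_convergence[OF N sets cos_conv prod(1) B order_refl, where t="\<lambda>_. 0" and b=0]
  show ?case by (auto intro: tendsto_mult_left)
next
  case (add f g)
  have int: "integrable K u" if "prob_space K" and sK: "sets K = sets (PiM {..<n} (\<lambda>_. borel))"
      and u: "u \<in> product_sums n" for K u
  proof -
    interpret prob_space K by fact
    have "u \<in> borel_measurable (PiM {..<n} (\<lambda>_. borel))"
      by (rule borel_measurable_continuous_on_PiE) (rule continuous_on_subset[OF product_sums_continuous[OF u]], simp)
    then have "u \<in> borel_measurable K" using sK by (simp cong: measurable_cong_sets)
    moreover obtain B where "\<bar>u x\<bar> \<le> B" for x
      using product_sums_bounded[OF u] unfolding bounded_iff by auto
    ultimately show ?thesis by (intro integrable_const_bound[of _ B]) auto
  qed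
  show ?case
    using add.IH by (simp add: int[OF N(1) sets(1)] int[OF N(2) sets(2)] add.hyps tendsto_add)
qed

text \<open>An approximation \<open>T\<close> of \<open>f\<close> on a box is multiplied by a
  cut-off, and the result \<open>T'\<close> stays in the algebra, so its integrals converge. The
  error \<open>f - T'\<close> is controlled everywhere by the cut-off, whose own integrals also
  converge.\<close>

lemma Levy_continuity_PiM:
  fixes N :: "nat \<Rightarrow> (nat \<Rightarrow> real) measure" and N' :: "(nat \<Rightarrow> real) measure" and f ::
      "(nat \<Rightarrow> real) \<Rightarrow> real"
  assumes N: "\<And>m. prob_space (N m)" "prob_space N'"
    and sets: "\<And>m. sets (N m) = sets (PiM {..<n} (\<lambda>_. borel))"
        "sets N' = sets (PiM {..<n} (\<lambda>_. borel))"
    and cos_conv: "\<And>t b. (\<lambda>m. \<integral>x. cos ((\<Sum>i<n. t i * x i) + b) \<partial>N m) \<longlonglongrightarrow>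
        (\<integral>x. cos ((\<Sum>i<n. t i * x i) + b) \<partial>N')"
    and f: "continuous_on (PiE {..<n} (\<lambda>_. UNIV)) f" "bounded (f ` PiE {..<n} (\<lambda>_. UNIV))"
  shows "(\<lambda>m. integral\<^sup>L (N m) f) \<longlonglongrightarrow> integral\<^sup>L N' f"
proof (rule LIMSEQ_I)
  fix e :: real assume "e > 0"
  obtain B where B: "B > 0" "\<And>x. x \<in> PiE {..<n} (\<lambda>_. UNIV) \<Longrightarrow> \<bar>f x\<bar> \<le> B"
    using f(2) unfolding bounded_pos by auto
  \<comment> \<open>The error budget: \<open>2 * B * d + d\<close> under \<open>N m\<close>,
    \<open>B * d + d\<close> under \<open>N'\<close>, and \<open>d\<close> for the difference of the
    two integrals of \<open>T'\<close>.\<close>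
  define d where "d = e / (3 * B + 3)"
  have d: "d > 0" "d * (3 * B + 3) = e" using \<open>e > 0\<close> B(1) by (auto simp: d_def)
  \<comment> \<open>A piecewise linear plateau: 1 on \<open>[-K, K]\<close> and 0 outside
    \<open>[-K - 1, K + 1]\<close>. The leading factor 1 in \<open>bump\<close> matches the shape of
    the rule \<open>prod\<close>.\<close>
  define cut where "cut K u = max 0 (min 1 (real K + 1 - \<bar>u\<bar>))" for K and u :: real
  define bump where "bump K x = 1 * (\<Prod>i<n. cut K (x i))" for K and x :: "nat \<Rightarrow> real"
  have cut: "0 \<le> cut K u" "cut K u \<le> 1" "\<bar>u\<bar> > real K + 1 \<Longrightarrow> cut K u = 0"
      "\<bar>u\<bar> \<le> real K \<Longrightarrow> cut K u = 1" for K u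
    by (auto simp: cut_def)
  have bump_product: "bump K \<in> product_sums n" for K
    unfolding bump_def using cut(1,2)
    by (intro product_sums.prod) (auto simp: cut_def bounded_iff intro!: continuous_intros exI[of _ 1])
  have bump: "0 \<le> bump K x" "bump K x \<le> 1" for K x
    using cut by (auto simp: bump_def intro!: prod_nonneg prod_le_1)
  have meas: "u \<in> borel_measurable M"
    if "sets M = sets (PiM {..<n} (\<lambda>_. borel))" "continuous_on (PiE {..<n} (\<lambda>_. UNIV)) u"
    for M and u :: "(nat \<Rightarrow> real) \<Rightarrow> real"
    using borel_measurable_continuous_on_PiE[OF that(2)] that(1)
        by (simp cong: measurable_cong_sets)
  note cont = continuous_on_subset[OF product_sums_continuous subset_UNIV]
  interpret N': prob_space N' by (rule N)
  \<comment> \<open>Only the limit law is examined here. The laws \<open>N m\<close> inherit the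
    small loss of mass for large \<open>m\<close> because \<open>bump K\<close> lies in the algebra;
    this takes the place of a tightness argument.\<close>
  have "(\<lambda>K. \<integral>x. bump K x \<partial>N') \<longlonglongrightarrow> (\<integral>x. 1 \<partial>N')"
  proof (rule integral_dominated_convergence[where w="\<lambda>_. 1"])
    have "(\<lambda>K. bump K x) \<longlonglongrightarrow> 1" for x
    proof (rule tendsto_eventually)
      obtain K0 where "(\<Sum>i<n. \<bar>x i\<bar>) \<le> real K0" using real_arch_simple by blast
      moreover have "\<bar>x i\<bar> \<le> (\<Sum>i<n. \<bar>x i\<bar>)" if "i < n" for i
        by (rule member_le_sum) (use that in auto)
      ultimately have "bump K x = 1" if "K \<ge> K0" for K
        using that unfolding bump_def by (force intro!: prod.neutral cut(4))
      then show "\<forall>\<^sub>F K in sequentially. bump K x = 1" by (rule eventually_sequentiallyI)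
    qed
    then show "AE x in N'. (\<lambda>K. bump K x) \<longlonglongrightarrow> 1" by simp
  qed (use bump meas[OF sets(2) cont[OF bump_product]] in auto)
  then have "\<forall>\<^sub>F K in sequentially. (\<integral>x. bump K x \<partial>N') > 1 - d"
    by (rule order_tendstoD(1)) (use d(1) N'.prob_space in simp)
  then obtain K where K: "(\<integral>x. bump K x \<partial>N') > 1 - d"
    by (auto simp: eventually_sequentially)
  \<comment> \<open>The radius is \<open>K + 1\<close>, not \<open>K\<close>, so that
    \<open>bump K\<close> vanishes outside the box.\<close>
  define S where "S = PiE {..<n} (\<lambda>_. {- (real K + 1)..real K + 1})"
  interpret function_ring_on "product_sums n" S
  proof
    show "compact S" unfolding S_def by (rule compact_PiE_box)
    fix x y assume xy: "x \<in> S" "y \<in> S" "x \<noteq> y"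
    then obtain i where i: "i < n" "x i \<noteq> y i"
      unfolding S_def by (meson PiE_ext lessThan_iff)
    \<comment> \<open>Coordinates are unbounded; \<open>arctan\<close> is a bounded continuous
      injective substitute that still separates points.\<close>
    have "(\<lambda>x. arctan (x i)) \<in> product_sums n"
    proof (intro product_sums_coordinate i(1) continuous_intros)
      have "\<bar>arctan u\<bar> \<le> pi / 2" for u using arctan_bounded[of u] by linarith
      then show "bounded (range arctan)" unfolding bounded_iff by (intro exI[of _ "pi / 2"]) simp
    qed
    with i(2) show "\<exists>f\<in>product_sums n. f x \<noteq> f y"
      by (intro bexI) (auto simp: arctan_eq_iff)
  qed (auto intro: product_sums.add product_sums_mult product_sums_const cont)
  have "continuous_on S f" by (rule continuous_on_subset[OF f(1)]) (auto simp: S_def)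
  from Stone_Weierstrass_basic[OF this d(1)] obtain T where
    T: "T \<in> product_sums n" "\<And>x. x \<in> S \<Longrightarrow> \<bar>f x - T x\<bar> < d" by auto
  define T' where "T' x = T x * bump K x" for x
  have T'R: "T' \<in> product_sums n" unfolding T'_def by (intro product_sums_mult T bump_product)
  \<comment> \<open>The difference splits as \<open>f * (1 - bump)\<close> plus
    \<open>(f - T) * bump\<close>. The second term is small on \<open>S\<close> by the choice of
    \<open>T\<close> and vanishes off \<open>S\<close> together with \<open>bump\<close>.\<close>
  have pointwise: "\<bar>f x - T' x\<bar> \<le> B * (1 - bump K x) + d" if x: "x \<in> PiE {..<n} (\<lambda>_. UNIV)" for x
  proof -
    have "\<bar>f x - T' x\<bar> \<le> \<bar>f x\<bar> * (1 - bump K x) + \<bar>f x - T x\<bar> * bump K x"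
    proof -
      have "f x - T' x = f x * (1 - bump K x) + (f x - T x) * bump K x"
          by (simp add: T'_def algebra_simps)
      then show ?thesis using bump[of K x]
          by (metis abs_mult abs_of_nonneg abs_triangle_ineq diff_ge_0_iff_ge)
    qed
    also have "\<bar>f x - T x\<bar> * bump K x \<le> d"
    proof (cases "x \<in> S")
      case True
      then show ?thesis using T(2)[OF True] bump[of K x] mult_mono[of "\<bar>f x - T x\<bar>" d
          "bump K x" 1] d(1) by simp
    next
      case False
      then obtain i where "i < n" "\<bar>x i\<bar> > real K + 1"
        using x by (auto simp: S_def PiE_iff abs_le_iff not_le)
      then have "bump K x = 0" using cut(3) by (auto simp: bump_def)
      then show ?thesis using d(1) by simp
    qed
    finally show ?thesis using mult_right_mono[OF B(2)[OF x], of "1 - bump K x"] bump[of K x]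
        by linarith
  qed
  have approx: "\<bar>integral\<^sup>L M f - integral\<^sup>L M T'\<bar> \<le> B * (1 - (\<integral>x. bump K x \<partial>M)) + d"
    if M: "prob_space M" "sets M = sets (PiM {..<n} (\<lambda>_. borel))" for M
  proof -
    interpret prob_space M by fact
    have sp: "space M = PiE {..<n} (\<lambda>_. UNIV)" using sets_eq_imp_space_eq[OF M(2)]
        by (simp add: space_PiM)
    have i1: "integrable M f"
      by (rule integrable_const_bound[of _ B]) (use B(2) meas[OF M(2) f(1)] in \<open>auto simp: sp\<close>)
    obtain C where "\<bar>T' x\<bar> \<le> C" for x
      using product_sums_bounded[OF T'R] unfolding bounded_iff by auto
    then have i2: "integrable M T'"
      by (intro integrable_const_bound[of _ C]) (use meas[OF M(2) cont[OF T'R]] in auto)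
    have i3: "integrable M (bump K)"
      by (rule integrable_const_bound[of _ 1])
          (use bump meas[OF M(2) cont[OF bump_product]] in auto)
    have "\<bar>integral\<^sup>L M f - integral\<^sup>L M T'\<bar> = \<bar>\<integral>x. f x - T' x \<partial>M\<bar>" using i1 i2 by simp
    also have "\<dots> \<le> (\<integral>x. \<bar>f x - T' x\<bar> \<partial>M)" by (rule integral_abs_bound)
    also have "\<dots> \<le> (\<integral>x. B * (1 - bump K x) + d \<partial>M)"
      by (rule integral_mono) (use i1 i2 i3 pointwise in \<open>auto simp: sp\<close>)
    also have "\<dots> = B * (1 - (\<integral>x. bump K x \<partial>M)) + d" using i3 by (simp add: prob_space)
    finally show ?thesis .
  qed
  note conv = product_sums_convergence[OF N sets cos_conv]
  have "(\<integral>x. bump K x \<partial>N') > 1 - 2 * d" using K d by simp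
  with conv[OF bump_product] have "\<forall>\<^sub>F m in sequentially. (\<integral>x. bump K x \<partial>N m) > 1 - 2 * d"
    by (rule order_tendstoD(1))
  moreover have "\<forall>\<^sub>F m in sequentially. \<bar>integral\<^sup>L (N m) T' - integral\<^sup>L N' T'\<bar> < d"
    using tendstoD[OF conv[OF T'R] d(1)] by (simp add: dist_real_def)
  ultimately have "\<forall>\<^sub>F m in sequentially. \<bar>integral\<^sup>L (N m) f - integral\<^sup>L N' f\<bar> < e"
  proof eventually_elim
    case (elim m)
    have "B * (1 - (\<integral>x. bump K x \<partial>N m)) \<le> B * (2 * d)" "B * (1 - (\<integral>x. bump K x \<partial>N')) \<le> B * d"
      using elim K B(1) by (auto intro!: mult_left_mono)
    with elim(2) approx[OF N(1) sets(1), of m] approx[OF N(2) sets(2)]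
    have "\<bar>integral\<^sup>L (N m) f - integral\<^sup>L N' f\<bar> < d * (3 * B + 3)"
      by (simp add: algebra_simps)
    then show ?case using d by simp
  qed
  then show "\<exists>m0. \<forall>m\<ge>m0. norm (integral\<^sup>L (N m) f - integral\<^sup>L N' f) < e"
    by (simp add: eventually_sequentially)
qed

text \<open>Cosines of linear combinations with an arbitrary phase carry the same information as the
  joint characteristic function. Passing to the laws of the tuples reduces the claim to the
  continuity theorem.\<close>

lemma converges_in_distributionI:
  assumes P: "prob_space P" and Q: "prob_space Q"
    and X [measurable]: "\<And>M i. i < n \<Longrightarrow> X M i \<in> borel_measurable P"
    and Y [measurable]: "\<And>i. i < n \<Longrightarrow> Y i \<in> borel_measurable Q"
    and cos_conv: "\<And>t b. (\<lambda>M. \<integral>\<omega>. cos ((\<Sum>i<n. t i * X M i \<omega>) + b) \<partial>P) \<longlonglongrightarrow>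
      (\<integral>\<omega>. cos ((\<Sum>i<n. t i * Y i \<omega>) + b) \<partial>Q)"
  shows "converges_in_distribution n P X Q Y"
proof -
  have X': "random_tuple n (X M) \<in> measurable P (PiM {..<n} (\<lambda>_. borel))" for M
    unfolding random_tuple_def using X by (intro measurable_restrict) auto
  have Y': "random_tuple n Y \<in> measurable Q (PiM {..<n} (\<lambda>_. borel))"
    unfolding random_tuple_def using Y by (intro measurable_restrict) auto
  have tr: "(\<integral>x. cos ((\<Sum>i<n. t i * x i) + b) \<partial>distr M (PiM {..<n} (\<lambda>_. borel)) (random_tuple n Z)) =
      (\<integral>\<omega>. cos ((\<Sum>i<n. t i * Z i \<omega>) + b) \<partial>M)"
    if "random_tuple n Z \<in> measurable M (PiM {..<n} (\<lambda>_. borel))" for M :: "'z measure" and Z t b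
    using that by (subst integral_distr) (auto simp: random_tuple_def)
  have "(\<lambda>M. \<integral>\<omega>. f (random_tuple n (X M) \<omega>) \<partial>P) \<longlonglongrightarrow> (\<integral>\<omega>. f (random_tuple n Y \<omega>) \<partial>Q)"
    if f: "continuous_on (PiE {..<n} (\<lambda>_. UNIV)) f" "bounded (f ` PiE {..<n} (\<lambda>_. UNIV))"
    for f :: "(nat \<Rightarrow> real) \<Rightarrow> real"
  proof -
    have "(\<lambda>M. integral\<^sup>L (distr P (PiM {..<n} (\<lambda>_. borel)) (random_tuple n (X M))) f) \<longlonglongrightarrow>
        integral\<^sup>L (distr Q (PiM {..<n} (\<lambda>_. borel)) (random_tuple n Y)) f"
      by (rule Levy_continuity_PiM[OF _ _ _ _ _ f])
        (simp_all add: tr[OF X'] tr[OF Y'] cos_conv prob_space.prob_space_distr P Q X' Y')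
    then show ?thesis
      using borel_measurable_continuous_on_PiE[OF f(1)] X' Y' by (simp add: integral_distr)
  qed
  with X' Y' show ?thesis unfolding converges_in_distribution_def by blast
qed

section \<open>Finite-rank Gaussian processes and the central limit theorem\<close>

interpretation std_normal: real_distribution std_normal_distribution
  by (rule real_dist_normal_dist)

abbreviation std_normal_PiM :: "'i set \<Rightarrow> ('i \<Rightarrow> real) measure" where
  "std_normal_PiM A \<equiv> PiM A (\<lambda>_. std_normal_distribution)"

lemma prob_space_std_normal_PiM: "prob_space (std_normal_PiM A)"
  by (intro prob_space_PiM std_normal.prob_space_axioms)

interpretation std_normal_product: product_sigma_finite "\<lambda>_. std_normal_distribution"
  by standard

lemma sets_std_normal_PiM [measurable_cong]: "sets (std_normal_PiM A) = sets (PiM A (\<lambda>_. borel))"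
  by (rule sets_PiM_cong) auto

section \<open>Moments of independent standard normal variables\<close>

lemma std_normal_moment_le_2:
  assumes "e \<le> 2"
  shows "(\<integral>u. u ^ e \<partial>std_normal_distribution) = (if e = 1 then 0 else 1)"
proof -
  consider "e = 0" | "e = 1" | "e = 2" using assms by linarith
  then show ?thesis
  proof cases
    case 1 then show ?thesis using std_normal_distribution_even_moments(1)[of 0] by simp
  next
    case 2 then show ?thesis using integral_std_normal_distribution_moment_odd[of 1] by simp
  next
    case 3 then show ?thesis using std_normal_distribution_even_moments(1)[of 1] by simp
  qed
qed

text \<open>By Fubini the integral factors into one-dimensional moments. For exponents 0, 1, 2 these
  are 1, 0, 1, so a single exponent 1 annihilates the product.\<close>

lemma
  assumes "finite A"
  shows integrable_std_normal_monomial: "integrable (std_normal_PiM A) (\<lambda>v. \<Prod>k\<in>A. v k ^ e k)"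
    and integral_std_normal_monomial: "(\<And>k. k \<in> A \<Longrightarrow> e k \<le> 2) \<Longrightarrow>
      (\<integral>v. (\<Prod>k\<in>A. v k ^ e k) \<partial>std_normal_PiM A) = (if \<exists>k\<in>A. e k = 1 then 0 else 1)"
proof -
  show "integrable (std_normal_PiM A) (\<lambda>v. \<Prod>k\<in>A. v k ^ e k)"
    by (intro std_normal_product.product_integrable_prod assms integrable_std_normal_distribution_moment)
  assume e: "\<And>k. k \<in> A \<Longrightarrow> e k \<le> 2"
  have "(\<integral>v. (\<Prod>k\<in>A. v k ^ e k) \<partial>std_normal_PiM A) = (\<Prod>k\<in>A. \<integral>u. u ^ e k \<partial>std_normal_distribution)"
    by (intro std_normal_product.product_integral_prod assms integrable_std_normal_distribution_moment)
  also have "\<dots> = (\<Prod>k\<in>A. if e k = 1 then 0 else 1)"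
    by (intro prod.cong refl std_normal_moment_le_2 e)
  also have "\<dots> = (if \<exists>k\<in>A. e k = 1 then 0 else 1)"
    using assms by auto
  finally show "(\<integral>v. (\<Prod>k\<in>A. v k ^ e k) \<partial>std_normal_PiM A) = (if \<exists>k\<in>A. e k = 1 then 0 else 1)" .
qed

text \<open>Expanding both sums leaves only the diagonal terms. This serves both the limit process,
  with \<open>V\<close> the coordinates of a Gaussian vector, and a network mode, with
  \<open>V\<close> the products of weights; hence the two variances agree.\<close>

lemma
  fixes V :: "'b \<Rightarrow> 'a \<Rightarrow> real"
  assumes "finite A"
    and int: "\<And>\<alpha> \<beta>. \<alpha> \<in> A \<Longrightarrow> \<beta> \<in> A \<Longrightarrow> integrable M (\<lambda>\<omega>. V \<alpha> \<omega> * V \<beta> \<omega>)"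
    and orth: "\<And>\<alpha> \<beta>. \<alpha> \<in> A \<Longrightarrow> \<beta> \<in> A \<Longrightarrow> (\<integral>\<omega>. V \<alpha> \<omega> * V \<beta> \<omega> \<partial>M) = (if \<alpha> = \<beta> then 1 else 0)"
  shows integrable_orthonormal_combination:
      "integrable M (\<lambda>\<omega>. (\<Sum>\<alpha>\<in>A. p \<alpha> * V \<alpha> \<omega>) * (\<Sum>\<alpha>\<in>A. q \<alpha> * V \<alpha> \<omega>))"
    and integral_orthonormal_combination:
      "(\<integral>\<omega>. (\<Sum>\<alpha>\<in>A. p \<alpha> * V \<alpha> \<omega>) * (\<Sum>\<alpha>\<in>A. q \<alpha> * V \<alpha> \<omega>) \<partial>M) = (\<Sum>\<alpha>\<in>A. p \<alpha> * q \<alpha>)"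
proof -
  have eq: "(\<Sum>\<alpha>\<in>A. p \<alpha> * V \<alpha> \<omega>) * (\<Sum>\<alpha>\<in>A. q \<alpha> * V \<alpha> \<omega>) =
      (\<Sum>\<alpha>\<in>A. \<Sum>\<beta>\<in>A. p \<alpha> * q \<beta> * (V \<alpha> \<omega> * V \<beta> \<omega>))" for \<omega>
    unfolding sum_product by (simp add: mult_ac)
  show "integrable M (\<lambda>\<omega>. (\<Sum>\<alpha>\<in>A. p \<alpha> * V \<alpha> \<omega>) * (\<Sum>\<alpha>\<in>A. q \<alpha> * V \<alpha> \<omega>))"
    unfolding eq using int by auto
  have "(\<integral>\<omega>. (\<Sum>\<alpha>\<in>A. p \<alpha> * V \<alpha> \<omega>) * (\<Sum>\<alpha>\<in>A. q \<alpha> * V \<alpha> \<omega>) \<partial>M) =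
      (\<Sum>\<alpha>\<in>A. \<Sum>\<beta>\<in>A. p \<alpha> * q \<beta> * (if \<alpha> = \<beta> then 1 else 0))"
    unfolding eq using int by (simp add: orth)
  also have "\<dots> = (\<Sum>\<alpha>\<in>A. p \<alpha> * q \<alpha>)"
    using \<open>finite A\<close> by (simp add: if_distrib[of "\<lambda>u. _ * u"] cong: if_cong)
  finally show "(\<integral>\<omega>. (\<Sum>\<alpha>\<in>A. p \<alpha> * V \<alpha> \<omega>) * (\<Sum>\<alpha>\<in>A. q \<alpha> * V \<alpha> \<omega>) \<partial>M) = (\<Sum>\<alpha>\<in>A. p \<alpha> * q \<alpha>)" .
qed

lemma
  assumes "finite A" "\<alpha> \<in> A"
  shows integrable_std_normal_PiM_coordinate: "integrable (std_normal_PiM A) (\<lambda>v. v \<alpha>)"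
    and integral_std_normal_PiM_coordinate: "(\<integral>v. v \<alpha> \<partial>std_normal_PiM A) = 0"
proof -
  have eq: "v \<alpha> = (\<Prod>k\<in>A. v k ^ (if k = \<alpha> then 1 else 0))" for v :: "'a \<Rightarrow> real"
    using assms by (simp add: if_distrib[of "\<lambda>e. _ ^ e"] cong: if_cong)
  show "integrable (std_normal_PiM A) (\<lambda>v. v \<alpha>)"
    by (subst eq) (rule integrable_std_normal_monomial[OF assms(1)])
  show "(\<integral>v. v \<alpha> \<partial>std_normal_PiM A) = 0"
    using integral_std_normal_monomial[OF assms(1), of "\<lambda>k. if k = \<alpha> then 1 else 0"] assms(2)
    by (subst eq) (auto split: if_splits)
qed

lemma
  assumes "finite A" "\<alpha> \<in> A" "\<beta> \<in> A"
  shows integrable_std_normal_PiM_mult: "integrable (std_normal_PiM A) (\<lambda>v. v \<alpha> * v \<beta>)"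
    and integral_std_normal_PiM_mult: "(\<integral>v. v \<alpha> * v \<beta> \<partial>std_normal_PiM A) = (if \<alpha> = \<beta> then 1 else 0)"
proof -
  let ?e = "\<lambda>k. (if k = \<alpha> then 1 else 0) + (if k = \<beta> then 1 else 0 :: nat)"
  have eq: "v \<alpha> * v \<beta> = (\<Prod>k\<in>A. v k ^ ?e k)" for v :: "'a \<Rightarrow> real"
    using assms by (simp add: power_add prod.distrib if_distrib[of "\<lambda>e. _ ^ e"] del: power_Suc cong:
        if_cong)
  show "integrable (std_normal_PiM A) (\<lambda>v. v \<alpha> * v \<beta>)"
    by (subst eq) (rule integrable_std_normal_monomial[OF assms(1)])
  show "(\<integral>v. v \<alpha> * v \<beta> \<partial>std_normal_PiM A) = (if \<alpha> = \<beta> then 1 else 0)"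
    using integral_std_normal_monomial[OF assms(1), of ?e] assms(2,3)
    by (subst eq) (auto split: if_splits)
qed

text \<open>Sums of independent normal variables are normal when every summand has positive
  variance, so zero coefficients are dropped first. If none remains, the combination is constantly
  0, the degenerate case.\<close>

lemma normal_rv_std_normal_combination:
  fixes b :: "'i \<Rightarrow> real"
  assumes "finite A"
  shows "normal_rv (std_normal_PiM A) (\<lambda>v. \<Sum>\<alpha>\<in>A. b \<alpha> * v \<alpha>)"
proof -
  define I where "I = {\<alpha>\<in>A. b \<alpha> \<noteq> 0}"
  have I: "finite I" "I \<subseteq> A" using assms by (auto simp: I_def)
  have eq: "(\<Sum>\<alpha>\<in>A. b \<alpha> * v \<alpha>) = (\<Sum>\<alpha>\<in>I. b \<alpha> * v \<alpha>)" for v :: "'i \<Rightarrow> real"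
    unfolding I_def using assms by (intro sum.mono_neutral_right) auto
  show ?thesis
  proof (cases "I = {}")
    case True
    then show ?thesis unfolding eq normal_rv_def by (intro disjI2) (auto intro!: exI[of _ 0])
  next
    case False
    interpret prob_space "std_normal_PiM A" by (rule prob_space_std_normal_PiM)
    have coord: "distr (std_normal_PiM A) std_normal_distribution (\<lambda>v. v \<alpha>) = std_normal_distribution" if "\<alpha> \<in> A" for \<alpha>
      using that by (intro distr_PiM_component std_normal.prob_space_axioms)
    have coord_distributed: "distributed (std_normal_PiM A) lborel (\<lambda>v. v \<alpha>) std_normal_density" if
        "\<alpha> \<in> A" for \<alpha>
      unfolding distributed_def using coord[OF that] that by (simp cong: distr_cong)
    have "indep_vars (\<lambda>_. std_normal_distribution) (\<lambda>\<alpha> v. v \<alpha>) A"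
    proof (subst indep_vars_iff_distr_eq_PiM')
      show "A \<noteq> {}" using False I by auto
      have "distr (std_normal_PiM A) (std_normal_PiM A) (\<lambda>v. \<lambda>i\<in>A. v i) = distr (std_normal_PiM A) (std_normal_PiM A) (\<lambda>v. v)"
        by (intro distr_cong refl) (auto simp: space_PiM PiE_def extensional_restrict)
      also have "\<dots> = PiM A (\<lambda>i. distr (std_normal_PiM A) std_normal_distribution (\<lambda>v. v i))"
        by (simp add: distr_id) (intro PiM_cong refl coord[symmetric])
      finally show "distr (std_normal_PiM A) (std_normal_PiM A) (\<lambda>v. \<lambda>i\<in>A. v i) =
          PiM A (\<lambda>i. distr (std_normal_PiM A) std_normal_distribution (\<lambda>v. v i))" .
    qed simp
    from indep_vars_compose2[OF indep_vars_subset[OF this I(2)], of "\<lambda>\<alpha> u. b \<alpha> * u" "\<lambda>_. borel"]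
    have indep: "indep_vars (\<lambda>_. borel) (\<lambda>\<alpha> v. b \<alpha> * v \<alpha>) I" by simp
    have "distributed (std_normal_PiM A) lborel (\<lambda>v. b \<alpha> * v \<alpha>) (normal_density 0 \<bar>b \<alpha>\<bar>)" if "\<alpha> \<in> I"
        for \<alpha>
      using normal_density_affine[OF coord_distributed, of \<alpha> "b \<alpha>" 0] that by (simp add: I_def)
    from sum_indep_normal[OF I(1) False indep _ this]
    have "distributed (std_normal_PiM A) lborel (\<lambda>v. \<Sum>\<alpha>\<in>I. b \<alpha> * v \<alpha>) (normal_density 0 (sqrt (\<Sum>\<alpha>\<in>I. \<bar>b \<alpha>\<bar>\<^sup>2)))"
      by (simp add: I_def)
    moreover have "sqrt (\<Sum>\<alpha>\<in>I. \<bar>b \<alpha>\<bar>\<^sup>2) > 0"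
      using I(1) False by (auto simp: I_def intro!: sum_pos)
    ultimately show ?thesis unfolding eq normal_rv_def by blast
  qed
qed

text \<open>The shifted cosine is the real part of \<open>iexp b\<close> times a product of
  exponentials, and Fubini turns the integral of that product into a product of standard normal
  characteristic functions.\<close>

lemma integral_cos_std_normal_combination:
  fixes p :: "'i \<Rightarrow> real"
  assumes "finite A"
  shows "(\<integral>v. cos ((\<Sum>\<alpha>\<in>A. p \<alpha> * v \<alpha>) + b) \<partial>std_normal_PiM A) = exp (- (\<Sum>\<alpha>\<in>A. (p \<alpha>)\<^sup>2) / 2) * cos b"
proof -
  interpret prob_space "std_normal_PiM A" by (rule prob_space_std_normal_PiM)
  have int: "integrable (std_normal_PiM A) (\<lambda>v. \<Prod>\<alpha>\<in>A. iexp (p \<alpha> * v \<alpha>))"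
    by (intro std_normal_product.product_integrable_prod assms std_normal.integrable_iexp) auto
  have "(CLINT v|std_normal_PiM A. \<Prod>\<alpha>\<in>A. iexp (p \<alpha> * v \<alpha>)) = (\<Prod>\<alpha>\<in>A. char std_normal_distribution (p \<alpha>))"
    unfolding char_def
    by (intro std_normal_product.product_integral_prod assms std_normal.integrable_iexp) auto
  also have "\<dots> = exp (- (\<Sum>\<alpha>\<in>A. (p \<alpha>)\<^sup>2) / 2)"
    unfolding char_std_normal_distribution
    by (simp add: exp_sum[OF assms, symmetric] sum_divide_distrib sum_negf flip: of_real_prod)
  finally have "Re (CLINT v|std_normal_PiM A. iexp b * (\<Prod>\<alpha>\<in>A. iexp (p \<alpha> * v \<alpha>))) =
      Re (iexp b * complex_of_real (exp (- (\<Sum>\<alpha>\<in>A. (p \<alpha>)\<^sup>2) / 2)))"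
    by simp
  also have "\<dots> = exp (- (\<Sum>\<alpha>\<in>A. (p \<alpha>)\<^sup>2) / 2) * cos b"
    by (simp add: Re_exp)
  also have "Re (CLINT v|std_normal_PiM A. iexp b * (\<Prod>\<alpha>\<in>A. iexp (p \<alpha> * v \<alpha>))) =
      (\<integral>v. Re (iexp b * (\<Prod>\<alpha>\<in>A. iexp (p \<alpha> * v \<alpha>))) \<partial>std_normal_PiM A)"
    by (subst integral_Re) (use int in auto)
  also have "(\<lambda>v. Re (iexp b * (\<Prod>\<alpha>\<in>A. iexp (p \<alpha> * v \<alpha>)))) = (\<lambda>v. cos ((\<Sum>\<alpha>\<in>A. p \<alpha> * v \<alpha>) + b))"
    by (simp add: exp_sum[OF assms, symmetric] exp_add[symmetric] Re_exp sum_distrib_left[symmetric] add.commute flip: of_real_sum)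
  finally show ?thesis .
qed

text \<open>The central limit theorem divides by a positive standard deviation \<open>s\<close>, so
  \<open>s\<close> is moved into the test function \<open>cos (s * u + b)\<close>. For variance 0
  all summands vanish almost surely and the integrand is \<open>cos b\<close>.\<close>

lemma (in prob_space) central_limit_cos:
  fixes X :: "nat \<Rightarrow> 'a \<Rightarrow> real"
  assumes indep: "indep_vars (\<lambda>_. borel) X UNIV"
    and distr: "\<And>m. distr M borel (X m) = \<mu>"
    and mean: "\<And>m. expectation (X m) = 0"
    and sq: "\<And>m. integrable M (\<lambda>\<omega>. (X m \<omega>)\<^sup>2)" "\<And>m. expectation (\<lambda>\<omega>. (X m \<omega>)\<^sup>2) = v"
  shows "(\<lambda>n. expectation (\<lambda>\<omega>. cos ((\<Sum>m<n. X m \<omega>) / sqrt n + b))) \<longlonglongrightarrow> exp (- v / 2) * cos b"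
proof -
  have rv [measurable]: "random_variable borel (X m)" for m
    using indep unfolding indep_vars_def2 by simp
  have "v \<ge> 0" unfolding sq(2)[of 0, symmetric] by simp
  show ?thesis
  proof (cases "v = 0")
    case True
    have "AE \<omega> in M. (X m \<omega>)\<^sup>2 = 0" for m
      by (rule integral_nonneg_eq_0_iff_AE[THEN iffD1]) (use sq True in auto)
    then have "AE \<omega> in M. \<forall>m. X m \<omega> = 0" by (simp add: AE_all_countable)
    then have "expectation (\<lambda>\<omega>. cos ((\<Sum>m<n. X m \<omega>) / sqrt n + b)) = expectation (\<lambda>\<omega>. cos b)" for n
      by (intro integral_cong_AE) auto
    then show ?thesis using True by (simp add: prob_space)
  next
    case False
    with \<open>v \<ge> 0\<close> have v: "v > 0" by simp
    define s where "s = sqrt v"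
    have s: "s > 0" "s\<^sup>2 = v" using v by (auto simp: s_def)
    have "weak_conv_m (\<lambda>n. distr M borel (\<lambda>\<omega>. (\<Sum>m<n. X m \<omega>) / sqrt (n * s\<^sup>2))) std_normal_distribution"
      by (rule central_limit_theorem_zero_mean[OF indep mean s(1) sq(1) _ distr]) (simp add: mean sq s)
    then have "(\<lambda>n. \<integral>u. cos (s * u + b) \<partial>distr M borel (\<lambda>\<omega>. (\<Sum>m<n. X m \<omega>) / sqrt (n * s\<^sup>2))) \<longlonglongrightarrow>
        (\<integral>u. cos (s * u + b) \<partial>std_normal_distribution)"
      by (rule weak_conv_imp_integral_bdd_continuous_conv[rotated 2, where B=1])
         (auto intro!: continuous_intros std_normal.real_distribution_axioms)
    moreover have "(\<integral>u. cos (s * u + b) \<partial>distr M borel (\<lambda>\<omega>. (\<Sum>m<n. X m \<omega>) / sqrt (n * s\<^sup>2))) =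
        expectation (\<lambda>\<omega>. cos ((\<Sum>m<n. X m \<omega>) / sqrt n + b))" for n
      by (subst integral_distr) (use s in \<open>auto simp: real_sqrt_mult\<close>)
    moreover have "(\<integral>u. cos (s * u + b) \<partial>std_normal_distribution) = exp (- v / 2) * cos b"
    proof -
      \<comment> \<open>A one-point index set presents the one-dimensional law as a product, so the
        formula for combinations applies.\<close>
      have "(\<integral>u. cos (s * u + b) \<partial>std_normal_distribution) =
          (\<integral>u. cos (s * u + b) \<partial>distr (std_normal_PiM {()}) std_normal_distribution (\<lambda>v. v ()))"
        by (subst distr_PiM_component) (auto intro: std_normal.prob_space_axioms)
      also have "\<dots> = (\<integral>v. cos (s * v () + b) \<partial>std_normal_PiM {()})"
        by (subst integral_distr) auto
      also have "\<dots> = exp (- v / 2) * cos b"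
        using integral_cos_std_normal_combination[of "{()}" "\<lambda>_. s" b] s by simp
      finally show ?thesis .
    qed
    ultimately show ?thesis by simp
  qed
qed

text \<open>Values of the process are linear in one fixed Gaussian vector, so any combination of
  them is again a combination of its coordinates, and covariances follow from
  orthonormality.\<close>

lemma centered_GP_finite_rank:
  fixes \<Phi> :: "'b \<Rightarrow> 'x \<Rightarrow> real"
  assumes "finite A"
  shows "centered_GP (std_normal_PiM A) (\<lambda>x v. \<Sum>\<alpha>\<in>A. \<Phi> \<alpha> x * v \<alpha>) (\<lambda>x y. \<Sum>\<alpha>\<in>A. \<Phi> \<alpha> x * \<Phi> \<alpha> y)"
  unfolding centered_GP_def multivariate_normal_def
proof (intro conjI allI impI)
  show "prob_space (std_normal_PiM A)" by (rule prob_space_std_normal_PiM)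
  have mean: "(\<integral>v. (\<Sum>\<alpha>\<in>A. \<Phi> \<alpha> x * v \<alpha>) \<partial>std_normal_PiM A) = 0" for x
    by (simp add: integrable_std_normal_PiM_coordinate integral_std_normal_PiM_coordinate assms)
  fix x :: "nat \<Rightarrow> 'x"
  show "normal_rv (std_normal_PiM A) (\<lambda>v. \<Sum>i<n. a i * (\<Sum>\<alpha>\<in>A. \<Phi> \<alpha> (x i) * v \<alpha>))" for n a
  proof -
    have "(\<Sum>i<n. a i * (\<Sum>\<alpha>\<in>A. \<Phi> \<alpha> (x i) * v \<alpha>)) = (\<Sum>\<alpha>\<in>A. (\<Sum>i<n. a i * \<Phi> \<alpha> (x i)) * v \<alpha>)" for v
      unfolding sum_distrib_left sum_distrib_right by (subst sum.swap) (simp add: mult_ac)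
    then show ?thesis using normal_rv_std_normal_combination[OF assms] by simp
  qed
  show "(\<integral>v. (\<Sum>\<alpha>\<in>A. \<Phi> \<alpha> (x i) * v \<alpha>) \<partial>std_normal_PiM A) = 0" for i by (rule mean)
  show "covariance (std_normal_PiM A) (\<lambda>v. \<Sum>\<alpha>\<in>A. \<Phi> \<alpha> (x i) * v \<alpha>) (\<lambda>v. \<Sum>\<alpha>\<in>A. \<Phi> \<alpha> (x j) * v \<alpha>) =
      (\<Sum>\<alpha>\<in>A. \<Phi> \<alpha> (x i) * \<Phi> \<alpha> (x j))" for i j
    unfolding covariance_def mean using assms
    by (simp add: integral_orthonormal_combination[where V="\<lambda>\<alpha> v. v \<alpha>"]
        integrable_std_normal_PiM_mult integral_std_normal_PiM_mult)
qed

section \<open>The network\<close>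

text \<open>Choosing one weight per dimension is a monomial in all weights of a mode, the form for
  which the moments are known.\<close>

lemma prod_component_eq_monomial:
  fixes v :: "'d::finite \<times> nat \<Rightarrow> real"
  assumes "\<alpha> \<in> (\<Pi>\<^sub>E d\<in>UNIV. {1..J d})"
  shows "(\<Prod>d\<in>UNIV. v (d, \<alpha> d)) = (\<Prod>k\<in>(SIGMA d:UNIV. {1..J d}). v k ^ (if snd k = \<alpha> (fst k) then 1 else 0))"
proof -
  have "(\<Prod>k\<in>(SIGMA d:UNIV. {1..J d}). v k ^ (if snd k = \<alpha> (fst k) then 1 else 0)) =
      (\<Prod>d\<in>UNIV. \<Prod>j\<in>{1..J d}. v (d, j) ^ (if j = \<alpha> d then 1 else 0))"
    by (simp add: prod.Sigma split_beta)
  also have "\<dots> = (\<Prod>d\<in>UNIV. v (d, \<alpha> d))"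
    using assms by (intro prod.cong refl) (auto simp: if_distrib[of "\<lambda>e. _ ^ e"] PiE_iff cong:
        if_cong)
  finally show ?thesis by simp
qed

text \<open>In the product of two monomials the exponent at \<open>(d, j)\<close> counts how many of
  \<alpha> and \<beta> choose \<open>j\<close> in dimension \<open>d\<close>. If they agree, all
  exponents are 0 or 2; where they differ, an exponent 1 appears.\<close>

lemma
  fixes J :: "'d::finite \<Rightarrow> nat"
  defines "K \<equiv> SIGMA d:UNIV. {1..J d}" and "A \<equiv> \<Pi>\<^sub>E d\<in>UNIV. {1..J d}"
  assumes \<alpha>: "\<alpha> \<in> A"
  shows integrable_prod_component: "integrable (std_normal_PiM K) (\<lambda>v. \<Prod>d\<in>UNIV. v (d, \<alpha> d))"
    and integral_prod_component: "(\<integral>v. (\<Prod>d\<in>UNIV. v (d, \<alpha> d)) \<partial>std_normal_PiM K) = 0"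
    and integrable_prod_component_mult: "\<beta> \<in> A \<Longrightarrow>
      integrable (std_normal_PiM K) (\<lambda>v. (\<Prod>d\<in>UNIV. v (d, \<alpha> d)) * (\<Prod>d\<in>UNIV. v (d, \<beta> d)))"
    and integral_prod_component_mult: "\<beta> \<in> A \<Longrightarrow>
      (\<integral>v. (\<Prod>d\<in>UNIV. v (d, \<alpha> d)) * (\<Prod>d\<in>UNIV. v (d, \<beta> d)) \<partial>std_normal_PiM K) = (if \<alpha> = \<beta> then 1 else 0)"
proof -
  define e :: "('d \<Rightarrow> nat) \<Rightarrow> 'd \<times> nat \<Rightarrow> nat" where "e \<gamma> k = (if snd k = \<gamma> (fst k) then 1 else 0)"
      for \<gamma> k
  have K: "finite K" by (auto simp: K_def)
  have mem: "(d, \<gamma> d) \<in> K" if "\<gamma> \<in> A" for \<gamma> d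
    using that by (auto simp: K_def A_def PiE_iff)
  have mono: "(\<Prod>d\<in>UNIV. v (d, \<gamma> d)) = (\<Prod>k\<in>K. v k ^ e \<gamma> k)" if "\<gamma> \<in> A" for \<gamma> and v ::
      "'d \<times> nat \<Rightarrow> real"
    unfolding e_def using that K_def A_def prod_component_eq_monomial by blast
  show "integrable (std_normal_PiM K) (\<lambda>v. \<Prod>d\<in>UNIV. v (d, \<alpha> d))"
    unfolding mono[OF \<alpha>] by (rule integrable_std_normal_monomial[OF K])
  have "(\<integral>v. (\<Prod>k\<in>K. v k ^ e \<alpha> k) \<partial>std_normal_PiM K) = (if \<exists>k\<in>K. e \<alpha> k = 1 then 0 else 1)"
    by (rule integral_std_normal_monomial[OF K]) (simp add: e_def)
  \<comment> \<open>Types are nonempty, so there is at least one dimension.\<close>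
  moreover have "\<exists>k\<in>K. e \<alpha> k = 1"
    by (rule bexI[OF _ mem[OF \<alpha>]]) (simp add: e_def)
  ultimately show "(\<integral>v. (\<Prod>d\<in>UNIV. v (d, \<alpha> d)) \<partial>std_normal_PiM K) = 0"
    unfolding mono[OF \<alpha>] by simp
  assume \<beta>: "\<beta> \<in> A"
  have mono2: "(\<Prod>d\<in>UNIV. v (d, \<alpha> d)) * (\<Prod>d\<in>UNIV. v (d, \<beta> d)) = (\<Prod>k\<in>K. v k ^ (e \<alpha> k + e \<beta> k))"
    for v :: "'d \<times> nat \<Rightarrow> real"
    unfolding mono[OF \<alpha>] mono[OF \<beta>] power_add prod.distrib ..
  show "integrable (std_normal_PiM K) (\<lambda>v. (\<Prod>d\<in>UNIV. v (d, \<alpha> d)) * (\<Prod>d\<in>UNIV. v (d, \<beta> d)))"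
    unfolding mono2 by (rule integrable_std_normal_monomial[OF K])
  have "(\<integral>v. (\<Prod>k\<in>K. v k ^ (e \<alpha> k + e \<beta> k)) \<partial>std_normal_PiM K) =
      (if \<exists>k\<in>K. e \<alpha> k + e \<beta> k = 1 then 0 else 1)"
    by (rule integral_std_normal_monomial[OF K]) (simp add: e_def)
  moreover have "(\<exists>k\<in>K. e \<alpha> k + e \<beta> k = 1) \<longleftrightarrow> \<alpha> \<noteq> \<beta>"
  proof
    show "\<exists>k\<in>K. e \<alpha> k + e \<beta> k = 1" if "\<alpha> \<noteq> \<beta>"
    proof -
      from that obtain d where "\<alpha> d \<noteq> \<beta> d" by auto
      then show ?thesis by (intro bexI[OF _ mem[OF \<alpha>, of d]]) (simp add: e_def)
    qed
  qed (auto simp: e_def split: if_splits)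
  ultimately show "(\<integral>v. (\<Prod>d\<in>UNIV. v (d, \<alpha> d)) * (\<Prod>d\<in>UNIV. v (d, \<beta> d)) \<partial>std_normal_PiM K) = (if \<alpha> = \<beta> then 1 else 0)"
    unfolding mono2 by simp
qed

section \<open>Independence and common law of the modes\<close>

lemma (in prob_space) indep_vars_reindex:
  assumes "inj_on h I" and indep: "indep_vars M' X (h ` I)"
  shows "indep_vars (\<lambda>i. M' (h i)) (\<lambda>i. X (h i)) I"
  unfolding indep_vars_def2
proof (intro conjI ballI)
  show "random_variable (M' (h i)) (X (h i))" if "i \<in> I" for i
    using indep that unfolding indep_vars_def2 by auto
  let ?F = "\<lambda>i. {X i -` A \<inter> space M |A. A \<in> sets (M' i)}"
  have ind: "indep_sets ?F (h ` I)" using indep unfolding indep_vars_def2 by auto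
  show "indep_sets (\<lambda>i. ?F (h i)) I"
  proof (rule indep_setsI)
    show "?F (h i) \<subseteq> events" if "i \<in> I" for i
      using ind that unfolding indep_sets_def by auto
    fix A J assume J: "J \<noteq> {}" "J \<subseteq> I" "finite J" and A: "\<forall>j\<in>J. A j \<in> ?F (h j)"
    have inj: "inj_on h J" using assms(1) J(2) by (rule inj_on_subset)
    define A' where "A' i = A (inv_into J h i)" for i
    have A': "A' (h j) = A j" if "j \<in> J" for j using inj that by (simp add: A'_def)
    have "prob (\<Inter>i\<in>h ` J. A' i) = (\<Prod>i\<in>h ` J. prob (A' i))"
      by (rule indep_setsD[OF ind]) (use J A A' in auto)
    then show "prob (\<Inter>j\<in>J. A j) = (\<Prod>j\<in>J. prob (A j))"
      using A' by (simp add: prod.reindex[OF inj])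
  qed
qed

text \<open>Disjoint blocks \<open>K \<times> {m}\<close> of an independent family are independent.
  Relabelling each block by \<open>K\<close> lets the same \<open>F\<close> act on every
  mode.\<close>

lemma (in prob_space) indep_vars_layers:
  assumes indep: "indep_vars (\<lambda>_. borel) Z (K \<times> UNIV)"
    and F [measurable]: "F \<in> borel_measurable (PiM K (\<lambda>_. borel))"
  shows "indep_vars (\<lambda>_. borel) (\<lambda>m \<omega>. F (\<lambda>k\<in>K. Z (k, m) \<omega>)) UNIV"
proof -
  let ?L = "\<lambda>m. K \<times> {m}"
  have [measurable]: "(\<lambda>v. \<lambda>k\<in>K. v (k, m)) \<in> measurable (PiM (?L m) (\<lambda>_. borel)) (PiM K (\<lambda>_. borel))" for m
    by (intro measurable_restrict measurable_component_singleton) auto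
  have eq: "(\<lambda>k\<in>K. (\<lambda>p\<in>?L m. Z p \<omega>) (k, m)) = (\<lambda>k\<in>K. Z (k, m) \<omega>)" for m \<omega>
    by (rule restrict_ext) auto
  have "indep_vars (\<lambda>m. PiM (?L m) (\<lambda>_. borel)) (\<lambda>m \<omega>. \<lambda>p\<in>?L m. Z p \<omega>) UNIV"
    by (rule indep_vars_restrict[OF indep]) (auto simp: disjoint_family_on_def)
  then have "indep_vars (\<lambda>_. borel) (\<lambda>m \<omega>. F (\<lambda>k\<in>K. (\<lambda>p\<in>?L m. Z p \<omega>) (k, m))) UNIV"
    by (rule indep_vars_compose2[where Y="\<lambda>m v. F (\<lambda>k\<in>K. v (k, m))"]) measurable
  then show ?thesis unfolding eq .
qed

text \<open>Independence makes the law of the block \<open>K \<times> {m}\<close> the product of its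
  marginals, and the injection sending \<open>k\<close> to \<open>(k, m)\<close> transports that
  product to the index set \<open>K\<close>.\<close>

lemma (in prob_space) distr_layer:
  fixes Z :: "'i \<times> nat \<Rightarrow> 'a \<Rightarrow> real"
  assumes indep: "indep_vars (\<lambda>_. borel) Z (K \<times> UNIV)"
    and std: "\<And>k m. k \<in> K \<Longrightarrow> distr M borel (Z (k, m)) = std_normal_distribution"
    and "K \<noteq> {}"
  shows "distr M (PiM K (\<lambda>_. borel)) (\<lambda>\<omega>. \<lambda>k\<in>K. Z (k, m) \<omega>) = std_normal_PiM K"
proof -
  let ?L = "K \<times> {m}"
  have pull: "(\<lambda>v. \<lambda>k\<in>K. v (k, m)) \<in> measurable (PiM ?L (\<lambda>_. borel)) (PiM K (\<lambda>_. borel :: real measure))"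
    by (intro measurable_restrict measurable_component_singleton) auto
  have eq: "(\<lambda>k\<in>K. (\<lambda>p\<in>?L. Z p \<omega>) (k, m)) = (\<lambda>k\<in>K. Z (k, m) \<omega>)" for \<omega>
    by (rule restrict_ext) auto
  have rv: "random_variable borel (Z p)" if "p \<in> ?L" for p
    using indep that unfolding indep_vars_def2 by auto
  have rv': "random_variable (PiM ?L (\<lambda>_. borel)) (\<lambda>\<omega>. \<lambda>p\<in>?L. Z p \<omega>)"
    by (intro measurable_restrict rv)
  have "indep_vars (\<lambda>_. borel) Z ?L"
    by (rule indep_vars_subset[OF indep]) auto
  with \<open>K \<noteq> {}\<close> rv have "distr M (PiM ?L (\<lambda>_. borel)) (\<lambda>\<omega>. \<lambda>p\<in>?L. Z p \<omega>) = PiM ?L (\<lambda>p. distr M borel (Z p))"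
    by (subst (asm) indep_vars_iff_distr_eq_PiM') auto
  also have "\<dots> = std_normal_PiM ?L"
    by (intro PiM_cong) (auto simp: std)
  finally have "distr (distr M (PiM ?L (\<lambda>_. borel)) (\<lambda>\<omega>. \<lambda>p\<in>?L. Z p \<omega>)) (PiM K (\<lambda>_. borel)) (\<lambda>v. \<lambda>k\<in>K. v (k, m)) =
      distr (std_normal_PiM ?L) (std_normal_PiM K) (\<lambda>v. \<lambda>k\<in>K. v (k, m))"
    by (intro distr_cong) (auto simp: sets_std_normal_PiM)
  also have "\<dots> = std_normal_PiM K"
    by (rule distr_PiM_reindex[of ?L "\<lambda>_. std_normal_distribution" "\<lambda>k. (k, m)" K])
      (auto intro: std_normal.prob_space_axioms inj_onI)
  finally show ?thesis
    by (subst (asm) distr_distr[OF pull rv']) (simp only: comp_def eq)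
qed

section \<open>Feature expansion of the kernel and of the network\<close>

definition binn_feature ::
    "('d::finite \<Rightarrow> nat \<Rightarrow> real) \<Rightarrow> ('d \<Rightarrow> real) \<Rightarrow> real \<Rightarrow> ('d \<Rightarrow> nat) \<Rightarrow> real ^ 'd \<Rightarrow> real" where
  "binn_feature c l \<sigma>w \<alpha> x = (\<Prod>d\<in>UNIV. \<sigma>w * gaussian_rbf (c d (\<alpha> d)) (l d) (x $ d))"

text \<open>Distributing the product over the sums gives one term per multi-index; in every
  dimension the variance is shared, one factor \<open>\<sigma>w\<close> for each feature.\<close>

lemma binn_kernel_eq_sum_features:
  fixes J :: "'d::finite \<Rightarrow> nat"
  shows "binn_kernel J c l \<sigma>w x y =
    (\<Sum>\<alpha>\<in>(\<Pi>\<^sub>E d\<in>UNIV. {1..J d}). binn_feature c l \<sigma>w \<alpha> x * binn_feature c l \<sigma>w \<alpha> y)"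
proof -
  have "binn_kernel J c l \<sigma>w x y = (\<Prod>d\<in>UNIV. \<Sum>j=1..J d.
      (\<sigma>w * gaussian_rbf (c d j) (l d) (x $ d)) * (\<sigma>w * gaussian_rbf (c d j) (l d) (y $ d)))"
    unfolding binn_kernel_def by (simp add: sum_distrib_left power2_eq_square mult_ac)
  also have "\<dots> = (\<Sum>\<alpha>\<in>(\<Pi>\<^sub>E d\<in>UNIV. {1..J d}). binn_feature c l \<sigma>w \<alpha> x * binn_feature c l \<sigma>w \<alpha> y)"
    by (subst prod_sum_PiE) (simp_all add: binn_feature_def prod.distrib)
  finally show ?thesis .
qed

text \<open>The factor \<open>\<sigma>w\<close> in the features compensates for dividing the weights
  by it, which gives them unit variance. Modes are renumbered from 0 to suit the central limit
  theorem, hence \<open>Suc m\<close>.\<close>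

lemma binn_normalized_eq_sum_features:
  fixes J :: "'d::finite \<Rightarrow> nat"
  assumes "\<sigma>w \<noteq> 0"
  shows "binn_normalized J c l w M x \<omega> = (\<Sum>m<M. \<Sum>\<alpha>\<in>(\<Pi>\<^sub>E d\<in>UNIV. {1..J d}).
    binn_feature c l \<sigma>w \<alpha> x * (\<Prod>d\<in>UNIV. w d (\<alpha> d) (Suc m) \<omega> / \<sigma>w)) / sqrt M"
proof -
  have "(\<Prod>d\<in>UNIV. \<Sum>j=1..J d. gaussian_rbf (c d j) (l d) (x $ d) * w d j m \<omega>) =
      (\<Sum>\<alpha>\<in>(\<Pi>\<^sub>E d\<in>UNIV. {1..J d}). binn_feature c l \<sigma>w \<alpha> x * (\<Prod>d\<in>UNIV. w d (\<alpha> d) m \<omega> / \<sigma>w))" for m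
    by (subst prod_sum_PiE) (use assms in \<open>simp_all add: binn_feature_def flip: prod.distrib\<close>)
  moreover have "{1..M} = Suc ` {..<M}"
    by (simp add: image_Suc_lessThan)
  ultimately show ?thesis
    unfolding binn_normalized_def binn_output_def by (simp add: sum.reindex)
qed

theorem theorem3p2:
  fixes P :: "'a measure"
    and J :: "'d::finite \<Rightarrow> nat"
    and c :: "'d \<Rightarrow> nat \<Rightarrow> real"
    and l :: "'d \<Rightarrow> real"
    and \<sigma>w :: real
    and w :: "'d \<Rightarrow> nat \<Rightarrow> nat \<Rightarrow> 'a \<Rightarrow> real"
  assumes "prob_space P"
    and "\<And>d. J d \<ge> 1"
    and "\<And>d. l d > 0"
    and "\<sigma>w > 0"
    and "prob_space.indep_vars P (\<lambda>_. borel) (\<lambda>(d, j, m). w d j m)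
           {(d, j, m). j \<in> {1..J d} \<and> m \<ge> 1}"
    and "\<And>d j m. j \<in> {1..J d} \<Longrightarrow> m \<ge> 1 \<Longrightarrow>
           distributed P lborel (w d j m) (normal_density 0 \<sigma>w)"
  shows "\<exists>(Q :: (real ^ 'd \<Rightarrow> real) measure) (g :: real ^ 'd \<Rightarrow> (real ^ 'd \<Rightarrow> real) \<Rightarrow> real).
           centered_GP Q g (binn_kernel J c l \<sigma>w) \<and>
           fdd_converges P (binn_normalized J c l w) Q g"
proof -
  interpret prob_space P by fact
  define K where "K = (SIGMA d:UNIV. {1..J d})"
  define A where "A = (\<Pi>\<^sub>E d\<in>UNIV. {1..J d})"
  define \<Phi> where "\<Phi> = binn_feature c l \<sigma>w"
  define V where "V \<alpha> v = (\<Prod>d\<in>UNIV. v (d, \<alpha> d))" for \<alpha> and v :: "'d \<times> nat \<Rightarrow> real"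
  have fin: "finite K" "finite A" by (auto simp: K_def A_def intro: finite_PiE)
  have mem: "(d, \<alpha> d) \<in> K" if "\<alpha> \<in> A" for \<alpha> d using that by (auto simp: K_def A_def PiE_iff)
  have "(undefined, 1) \<in> K" using assms(2) by (simp add: K_def)
  then have "K \<noteq> {}" by auto
  have V_meas [measurable]: "V \<alpha> \<in> borel_measurable (PiM K (\<lambda>_. borel))" if "\<alpha> \<in> A" for \<alpha>
    unfolding V_def using mem[OF that]
        by (intro borel_measurable_prod measurable_component_singleton)
  note V_moments = integrable_prod_component[where J=J, folded K_def A_def V_def]
    integral_prod_component[where J=J, folded K_def A_def V_def]
    integrable_prod_component_mult[where J=J, folded K_def A_def V_def]
    integral_prod_component_mult[where J=J, folded K_def A_def V_def]

  \<comment> \<open>A weight is indexed by its position \<open>(d, j)\<close> within a mode and by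
    the mode, counted from 0, so that modes become the layers of a product index set.\<close>
  define Z where "Z p \<omega> = w (fst (fst p)) (snd (fst p)) (Suc (snd p)) \<omega> / \<sigma>w" for p \<omega>
  have Z: "indep_vars (\<lambda>_. borel) Z (K \<times> UNIV)"
  proof -
    let ?h = "\<lambda>((d, j), m). (d, j, Suc m)"
    have "?h ` (K \<times> UNIV) = {(d, j, m). j \<in> {1..J d} \<and> m \<ge> 1}" (is "_ = ?I")
    proof
      show "?I \<subseteq> ?h ` (K \<times> UNIV)"
      proof
        fix p assume "p \<in> ?I"
        then obtain d j m where "p = (d, j, m)" "j \<in> {1..J d}" "m \<ge> 1" by blast
        then show "p \<in> ?h ` (K \<times> UNIV)"
          by (intro image_eqI[of _ _ "((d, j), m - 1)"]) (auto simp: K_def)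
      qed
    qed (auto simp: K_def)
    moreover have "inj_on ?h (K \<times> UNIV)"
      by (auto simp: inj_on_def)
    ultimately have "indep_vars (\<lambda>_. borel) (\<lambda>p. (\<lambda>(d, j, m). w d j m) (?h p)) (K \<times> UNIV)"
      using assms(5) indep_vars_reindex[of ?h "K \<times> UNIV" "\<lambda>_. borel" "\<lambda>(d, j, m). w d j m"] by simp
    from indep_vars_compose2[OF this, of "\<lambda>_ u. u / \<sigma>w" "\<lambda>_. borel"]
    show ?thesis
      by (simp add: Z_def[abs_def] split_beta)
  qed
  have Z_distr: "distr P borel (Z (k, m)) = std_normal_distribution" if "k \<in> K" for k m
  proof -
    obtain d j where k: "k = (d, j)" "j \<in> {1..J d}" using \<open>k \<in> K\<close> by (auto simp: K_def)
    from normal_density_affine[OF assms(6)[OF k(2), of "Suc m"], of "1 / \<sigma>w" 0]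
    have "distributed P lborel (Z (k, m)) std_normal_density"
      using assms(4) by (simp add: Z_def[abs_def] k)
    then show ?thesis by (simp add: distributed_def cong: distr_cong)
  qed
  have Z_meas [measurable]: "(\<lambda>\<omega>. \<lambda>k\<in>K. Z (k, m) \<omega>) \<in> measurable P (PiM K (\<lambda>_. borel))" for m
    using Z by (intro measurable_restrict) (auto simp: indep_vars_def2)
  have law: "distr P (PiM K (\<lambda>_. borel)) (\<lambda>\<omega>. \<lambda>k\<in>K. Z (k, m) \<omega>) = std_normal_PiM K" for m
    by (rule distr_layer[OF Z Z_distr \<open>K \<noteq> {}\<close>])
  have binn: "binn_normalized J c l w M x \<omega> = (\<Sum>m<M. \<Sum>\<alpha>\<in>A. \<Phi> \<alpha> x * V \<alpha> (\<lambda>k\<in>K. Z (k, m) \<omega>)) / sqrt M"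
      for M x \<omega>
    unfolding \<Phi>_def A_def
    by (subst binn_normalized_eq_sum_features[of \<sigma>w])
      (use assms(4) mem in \<open>auto simp: V_def Z_def A_def intro!: sum.cong\<close>)

  \<comment> \<open>The process has to live on functions on \<open>real ^ 'd\<close>, so the multi-indices are encoded as points.\<close>
  define code :: "('d \<Rightarrow> nat) \<Rightarrow> real ^ 'd" where "code \<alpha> = (\<chi> d. real (\<alpha> d))" for \<alpha>
  define decode :: "real ^ 'd \<Rightarrow> 'd \<Rightarrow> nat" where "decode a d = nat \<lfloor>a $ d\<rfloor>" for a d
  have decode [simp]: "decode (code \<alpha>) = \<alpha>" for \<alpha> by (simp add: fun_eq_iff decode_def code_def)
  then have inj: "inj_on code A" by (metis inj_onI)
  define Q where "Q = std_normal_PiM (code ` A)"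
  define g where "g x v = (\<Sum>a\<in>code ` A. \<Phi> (decode a) x * v a)" for x and v :: "real ^ 'd \<Rightarrow> real"
  have "centered_GP Q g (\<lambda>x y. \<Sum>a\<in>code ` A. \<Phi> (decode a) x * \<Phi> (decode a) y)"
    unfolding Q_def g_def by (rule centered_GP_finite_rank) (simp add: fin)
  also have "(\<lambda>x y. \<Sum>a\<in>code ` A. \<Phi> (decode a) x * \<Phi> (decode a) y) = binn_kernel J c l \<sigma>w"
    by (intro ext) (simp only: sum.reindex[OF inj] comp_def decode binn_kernel_eq_sum_features \<Phi>_def A_def[symmetric])
  finally have GP: "centered_GP Q g (binn_kernel J c l \<sigma>w)" .

  have "converges_in_distribution n P (\<lambda>M i. binn_normalized J c l w M (x i)) Q (\<lambda>i. g (x i))"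
      for n x
  proof (rule converges_in_distributionI)
    show "prob_space P" "prob_space Q" by (fact, simp add: Q_def prob_space_std_normal_PiM)
    show "binn_normalized J c l w M (x i) \<in> borel_measurable P" for M i
      unfolding binn[abs_def] by measurable
    show "g (x i) \<in> borel_measurable Q" for i
      unfolding g_def[abs_def] Q_def by measurable
    fix t b
    \<comment> \<open>The coefficient of coordinate \<alpha> in the tested combination. It is the
      same for a mode and for the limit process, so both have variance
      \<open>\<Sum>\<alpha>\<in>A. (p \<alpha>)\<^sup>2\<close>.\<close>
    define p where "p \<alpha> = (\<Sum>i<n. t i * \<Phi> \<alpha> (x i))" for \<alpha>
    define F where "F v = (\<Sum>\<alpha>\<in>A. p \<alpha> * V \<alpha> v)" for v
    have F [measurable]: "F \<in> borel_measurable (PiM K (\<lambda>_. borel))"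
      unfolding F_def[abs_def] by measurable
    have tr: "(\<integral>\<omega>. f (\<lambda>k\<in>K. Z (k, m) \<omega>) \<partial>P) = integral\<^sup>L (std_normal_PiM K) f"
      "integrable P (\<lambda>\<omega>. f (\<lambda>k\<in>K. Z (k, m) \<omega>)) = integrable (std_normal_PiM K) f"
      if "f \<in> borel_measurable (PiM K (\<lambda>_. borel))" for f :: "_ \<Rightarrow> real" and m
      unfolding law[of m, symmetric] using that
          by - (simp_all add: integral_distr integrable_distr_eq)
    have sq: "integrable (std_normal_PiM K) (\<lambda>v. (F v)\<^sup>2)"
        "(\<integral>v. (F v)\<^sup>2 \<partial>std_normal_PiM K) = (\<Sum>\<alpha>\<in>A. (p \<alpha>)\<^sup>2)"
      unfolding power2_eq_square F_def
      by (rule integrable_orthonormal_combination integral_orthonormal_combination; use fin V_moments in simp)+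
    have "(\<lambda>M. expectation (\<lambda>\<omega>. cos ((\<Sum>m<M. F (\<lambda>k\<in>K. Z (k, m) \<omega>)) / sqrt M + b))) \<longlonglongrightarrow>
        exp (- (\<Sum>\<alpha>\<in>A. (p \<alpha>)\<^sup>2) / 2) * cos b"
    proof (rule central_limit_cos[OF indep_vars_layers[OF Z F]])
      show "distr P borel (\<lambda>\<omega>. F (\<lambda>k\<in>K. Z (k, m) \<omega>)) = distr (std_normal_PiM K) borel F" for m
        unfolding law[of m, symmetric] by (subst distr_distr) (auto simp: comp_def)
      show "expectation (\<lambda>\<omega>. F (\<lambda>k\<in>K. Z (k, m) \<omega>)) = 0" for m
        by (subst tr(1)) (auto simp: F_def[abs_def] V_moments)
    qed (use sq tr[of "\<lambda>v. (F v)\<^sup>2"] in simp_all)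
    moreover have "(\<Sum>i<n. t i * binn_normalized J c l w M (x i) \<omega>) = (\<Sum>m<M. F (\<lambda>k\<in>K. Z (k, m) \<omega>)) / sqrt M" for M \<omega>
    proof -
      have "(\<Sum>i<n. t i * (\<Sum>m<M. \<Sum>\<alpha>\<in>A. \<Phi> \<alpha> (x i) * V \<alpha> (\<lambda>k\<in>K. Z (k, m) \<omega>))) =
          (\<Sum>m<M. \<Sum>\<alpha>\<in>A. \<Sum>i<n. t i * (\<Phi> \<alpha> (x i) * V \<alpha> (\<lambda>k\<in>K. Z (k, m) \<omega>)))"
        unfolding sum_distrib_left by (subst sum.swap, intro sum.cong refl, rule sum.swap)
      then show ?thesis
        by (simp add: binn F_def p_def sum_distrib_right mult.assoc flip: sum_divide_distrib)
    qed
    \<comment> \<open>For the limit process the same value is exact, by the Gaussian formula in the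
      encoded coordinates.\<close>
    moreover have "(\<integral>v. cos ((\<Sum>i<n. t i * g (x i) v) + b) \<partial>Q) = exp (- (\<Sum>\<alpha>\<in>A. (p \<alpha>)\<^sup>2) / 2) * cos b"
    proof -
      have "(\<Sum>i<n. t i * g (x i) v) = (\<Sum>a\<in>code ` A. p (decode a) * v a)" for v
        unfolding g_def p_def sum_distrib_left sum_distrib_right
            by (subst sum.swap) (simp add: mult.assoc)
      then show ?thesis
        using integral_cos_std_normal_combination[of "code ` A" "\<lambda>a. p (decode a)" b] fin
        by (simp add: Q_def sum.reindex[OF inj])
    qed
    ultimately show "(\<lambda>M. \<integral>\<omega>. cos ((\<Sum>i<n. t i * binn_normalized J c l w M (x i) \<omega>) + b) \<partial>P) \<longlonglongrightarrow>
        (\<integral>v. cos ((\<Sum>i<n. t i * g (x i) v) + b) \<partial>Q)"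
      by simp
  qed
  with GP show ?thesis unfolding fdd_converges_def by blast
qed

end
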